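(* Let $X$ and $Y$ be Banach spaces, $S\in\mathcal{L}(X,Y)$, $F\subset X$ convex and $n\in\mathbb{N}$. Then \[ \Big(\prod_{k=0}^{2n-1} e_k^{\text{det-non}}(S,F)\Big)^{1/(2n)}\;\le\;2^{7/2}\,n^{3/2}\Big(\prod_{k=0}^{n-1} e_k^{\text{ran}}(S,F)\Big)^{1/n}. \] If $F$ is additionally symmetric, or if $Y$ is a Hilbert space, the factor $n^{3/2}$ can be replaced by $n$; if $F$ is symmetric and $Y$ is a Hilbert space, it can be replaced by $n^{1/2}$.
   Context: $\mathcal{L}(X,Y)$ denotes bounded linear operators, $X'$ the dual of $X$. A deterministic adaptive algorithm with $n$ measurements is a map $A_n=\phi\circ N_n\colon F\to Y$ where $\phi\colon\mathbb{R}^n\to Y$ is arbitrary and $N_n(f)=(y_1,\dots,y_n)$ with $y_1=L_1(f)$ and $y_k=L_k^{(y_1,\dots,y_{k-1})}(f)$, where each $L_k^{(\cdot)}\in X'$ may depend arbitrarily on the previously observed values; it is non-adaptive if $L_1,\dots,L_n\in X'$ are fixed. (For $n=0$ the algorithm outputs a constant.) The worst-case error is $e(A_n,S,F)=\sup_{f\in F}\|S(f)-A_n(f)\|_Y$. A randomized algorithm is a family $(A_n^\omega)_{\omega\in\Omega}$ of deterministic adaptive algorithms indexed by a probability space $(\Omega,\mathcal{A},\mathbb{P})$ such that $(f,\omega)\mapsto\|S(f)-A_n^\omega(f)\|_Y$ is $\mathcal{B}_F\otimes\mathcal{A}$-measurable, where $\mathcal{B}_F$ is the Borel $\sigma$-algebra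 on $F$ of the seminorm whose unit ball is $F-F$; its error is $\sup_{f\in F}\mathbb{E}\|S(f)-A_n^\omega(f)\|_Y$. The minimal errors $e_n^{\text{det-non}}(S,F)$ and $e_n^{\text{ran}}(S,F)$ are the infima of the error over all deterministic non-adaptive algorithms, respectively over all randomized (possibly adaptive) algorithms, with $n$ measurements. *)

theory Defs
  imports "HOL-Probability.Probability"
begin

text \<open>Information of a (possibly adaptive) deterministic algorithm with measurement
  maps L: the k-th functional L k ys may depend on the previously observed
  values ys = [y_1,...,y_(k-1)] (0-based: L 0 [] is the first functional).\<close>
fun info :: "(nat \<Rightarrow> real list \<Rightarrow> 'a \<Rightarrow> real) \<Rightarrow> nat \<Rightarrow> 'a \<Rightarrow> real list" where
  "info L 0 f = []"
| "info L (Suc k) f = (let ys = info L k f in ys @ [L k ys f])"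

definition adaptive_info :: "(nat \<Rightarrow> real list \<Rightarrow> 'a::real_normed_vector \<Rightarrow> real) \<Rightarrow> nat \<Rightarrow> bool" where
  "adaptive_info L n \<longleftrightarrow> (\<forall>k<n. \<forall>ys. bounded_linear (L k ys))"

definition wc_error :: "('a \<Rightarrow> 'b::real_normed_vector) \<Rightarrow> 'a set \<Rightarrow> ('a \<Rightarrow> 'b) \<Rightarrow> ennreal" where
  "wc_error S F A = (SUP f\<in>F. ennreal (norm (S f - A f)))"

definition e_det_non :: "('a::real_normed_vector \<Rightarrow> 'b::real_normed_vector) \<Rightarrow> 'a set \<Rightarrow> nat \<Rightarrow> ennreal" where
  "e_det_non S F n = (INF (L, phi) \<in> {(L :: nat \<Rightarrow> 'a \<Rightarrow> real, phi :: real list \<Rightarrow> 'b).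
        \<forall>k<n. bounded_linear (L k)}.
      wc_error S F (\<lambda>f. phi (map (\<lambda>k. L k f) [0..<n])))"

definition gauge_diff :: "'a::real_vector set \<Rightarrow> 'a \<Rightarrow> ennreal" where
  "gauge_diff F x = (INF t \<in> {t::real. t > 0 \<and> x \<in> (\<lambda>z. t *\<^sub>R z) ` {f - g |f g. f \<in> F \<and> g \<in> F}}. ennreal t)"

definition borel_F :: "'a::real_vector set \<Rightarrow> 'a measure" where
  "borel_F F = sigma F {U. U \<subseteq> F \<and> (\<forall>f\<in>U. \<exists>r>0. \<forall>g\<in>F. gauge_diff F (g - f) < ennreal r \<longrightarrow> g \<in> U)}"

definition e_ran :: "'c itself \<Rightarrow> ('a::real_normed_vector \<Rightarrow> 'b::real_normed_vector) \<Rightarrow> 'a set \<Rightarrow> nat \<Rightarrow> ennreal" where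
  "e_ran _ S F n = (INF (M, L, phi) \<in> {(M :: 'c measure, L :: 'c \<Rightarrow> nat \<Rightarrow> real list \<Rightarrow> 'a \<Rightarrow> real,
            phi :: 'c \<Rightarrow> real list \<Rightarrow> 'b).
        prob_space M \<and> (\<forall>\<omega>\<in>space M. adaptive_info (L \<omega>) n) \<and>
        (\<lambda>(f, \<omega>). norm (S f - phi \<omega> (info (L \<omega>) n f))) \<in> borel_measurable (borel_F F \<Otimes>\<^sub>M M)}.
      (SUP f\<in>F. \<integral>\<^sup>+ \<omega>. ennreal (norm (S f - phi \<omega> (info (L \<omega>) n f))) \<partial>M))"

definition hilbert_norm :: "'b::real_normed_vector itself \<Rightarrow> bool" where
  "hilbert_norm _ \<longleftrightarrow> (\<exists>ip :: 'b \<Rightarrow> 'b \<Rightarrow> real.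
      (\<forall>x y. ip x y = ip y x) \<and> (\<forall>x. linear (ip x)) \<and> (\<forall>x. norm x = sqrt (ip x x)))"

definition symmetric_set :: "'a::real_vector set \<Rightarrow> bool" where
  "symmetric_set F \<longleftrightarrow> (\<forall>x\<in>F. - x \<in> F)"

definition eroot :: "nat \<Rightarrow> ennreal \<Rightarrow> ennreal" where
  "eroot m x = (if x = \<top> then \<top> else ennreal (root m (enn2real x)))"

end

theory Submission
  imports Defs "Jordan_Normal_Form.Determinant"
begin

text \<open>
  Write \<open>N = 2n\<close>. Whenever \<open>c\<^sub>k\<close> is below the \<open>k\<close>-th deterministic error for all \<open>k < N\<close>, one chooses
  greedily differences \<open>h\<^sub>k \<in> F - F\<close> and functionals \<open>\<xi>\<^sub>k\<close> of norm one such that the matrix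
  \<open>\<xi>\<^sub>i(S h\<^sub>k)\<close> is lower triangular with \<open>k\<close>-th diagonal entry above \<open>c\<^sub>k\<close>. A ball of \<open>\<real>\<^sup>N\<close> maps
  into \<open>F\<close> along the \<open>h\<^sub>k\<close>, and \<open>y \<mapsto> (\<xi>\<^sub>i y)\<close> maps \<open>Y\<close> boundedly into \<open>\<real>\<^sup>N\<close>, so after scaling
  \<open>S\<close> dominates a matrix \<open>T\<close> whose singular values \<open>\<sigma>\<^sub>0 \<ge> \<sigma>\<^sub>1 \<ge> \<dots>\<close> multiply to its determinant.
  On the span of the first \<open>2k+1\<close> right singular vectors the problem is at least as hard as
  \<open>\<sigma>\<^bsub>2k\<^esub>\<close> times approximating the identity on the Euclidean unit ball of dimension \<open>m = 2k+1\<close>.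
  For that problem take the input \<open>x\<close> with density proportional to \<open>(1 - |x|\<^sup>2)\<^sup>-\<^sup>1\<^sup>/\<^sup>2\<close>: it is rotation
  invariant and its hyperplane sections are again of this form, so by induction \<open>k\<close> adaptive
  measurements leave an average error of at least \<open>E(x\<^sub>1\<^sup>2 + \<dots> + x\<^bsub>m-k\<^esub>\<^sup>2) = (m-k)/(m+1) = 1/2\<close>.
  Hence the \<open>k\<close>-th randomized error is at least \<open>\<sigma>\<^bsub>2k\<^esub>/2\<close>, and \<open>\<sigma>\<^bsub>2k+1\<^esub> \<le> \<sigma>\<^bsub>2k\<^esub>\<close> gives the claim.
\<close>

section \<open>Norming functionals\<close>

definition sublinear_fn :: "('a::real_vector \<Rightarrow> real) \<Rightarrow> bool" where
  "sublinear_fn p \<longleftrightarrow> (\<forall>x y. p (x + y) \<le> p x + p y) \<and> (\<forall>t x. 0 \<le> t \<longrightarrow> p (t *\<^sub>R x) = t * p x)"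

lemma sublinear_fn_neg:
  assumes "sublinear_fn p"
  shows "p 0 = 0" "- p (- x) \<le> p x"
proof -
  show 0: "p 0 = 0"
    using assms[unfolded sublinear_fn_def, THEN conjunct2, rule_format, of 0 0] by simp
  show "- p (- x) \<le> p x"
    using assms[unfolded sublinear_fn_def, THEN conjunct1, rule_format, of x "- x"] 0 by simp
qed

text \<open>The witness is the infimum over \<open>t \<ge> 0\<close> of
  \<open>p (x + t y) - t p y\<close>: \<open>t = 0\<close> puts it below \<open>p\<close>, and
  \<open>t = 1\<close> at the point \<open>- y\<close> gives \<open>- p y\<close>. It serves twice:
  it forces a minimal functional to be odd, and it lowers the norm in one direction before a linear
  minorant is chosen.\<close>

lemma sublinear_fn_reduce:
  fixes p :: "'a::real_vector \<Rightarrow> real"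
  assumes p: "sublinear_fn p"
  shows "\<exists>q. sublinear_fn q \<and> (\<forall>x. q x \<le> p x) \<and> q (- y) \<le> - p y"
proof -
  have sub: "p (a + b) \<le> p a + p b" for a b using p by (auto simp: sublinear_fn_def)
  have hom: "0 \<le> t \<Longrightarrow> p (t *\<^sub>R a) = t * p a" for t a using p by (auto simp: sublinear_fn_def)
  define h where "h x t = p (x + t *\<^sub>R y) - t * p y" for x t
  define q where "q x = (INF t\<in>{0..}. h x t)" for x
  \<comment> \<open>Subadditivity for \<open>t y = (x + t y) + (- x)\<close>; the bound is
    independent of \<open>t\<close>, so the infimum is over a set bounded below.\<close>
  have lower: "- p (- x) \<le> h x t" if "0 \<le> t" for x t
    using sub[of "x + t *\<^sub>R y" "- x"] hom[OF that, of y] by (simp add: h_def)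
  have bdd: "bdd_below (h x ` {0..})" for x
    using lower by (auto intro!: bdd_belowI2[where m = "- p (- x)"])
  have q_le: "q x \<le> h x t" if "0 \<le> t" for x t
    unfolding q_def using that by (intro cINF_lower bdd) auto
  have q_ge: "c \<le> q x" if "\<And>t. 0 \<le> t \<Longrightarrow> c \<le> h x t" for c x
    unfolding q_def using that by (intro cINF_greatest) auto
  have add: "q (a + b) \<le> q a + q b" for a b
  proof -
    have "q (a + b) \<le> h a s + h b t" if "0 \<le> s" "0 \<le> t" for s t
    proof -
      have "q (a + b) \<le> h (a + b) (s + t)" using that by (intro q_le) auto
      also have "\<dots> \<le> h a s + h b t"
        using sub[of "a + s *\<^sub>R y" "b + t *\<^sub>R y"] by (simp add: h_def algebra_simps)
      finally show ?thesis .
    qed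
    then have "q (a + b) - h a s \<le> q b" if "0 \<le> s" for s
      using that by (intro q_ge) (simp add: algebra_simps)
    then have "q (a + b) - q b \<le> q a"
      by (intro q_ge) (simp add: algebra_simps)
    then show ?thesis by simp
  qed
  have le: "q (t *\<^sub>R a) \<le> t * q a" if "0 < t" for t a
  proof -
    have "q (t *\<^sub>R a) / t \<le> q a"
    proof (rule q_ge)
      fix s :: real assume "0 \<le> s"
      then have "q (t *\<^sub>R a) \<le> h (t *\<^sub>R a) (t * s)" using that by (intro q_le) auto
      also have "\<dots> = t * h a s"
        using hom[of t "a + s *\<^sub>R y"] that by (simp add: h_def algebra_simps)
      finally show "q (t *\<^sub>R a) / t \<le> h a s" using that by (simp add: field_simps)
    qed
    then show ?thesis using that by (simp add: field_simps)
  qed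
  have q0: "q 0 = 0"
  proof (rule antisym)
    show "q 0 \<le> 0" using q_le[of 0 0] sublinear_fn_neg[OF p] by (simp add: h_def)
    show "0 \<le> q 0" using lower[of _ 0] sublinear_fn_neg[OF p] by (intro q_ge) simp
  qed
  have "q (t *\<^sub>R a) = t * q a" if "0 \<le> t" for t a
  proof (cases "t = 0")
    case False
    with that have t: "0 < t" by simp
    \<comment> \<open>The reverse inequality is \<open>le\<close> for the factor
      \<open>1 / t\<close> at the point \<open>t a\<close>.\<close>
    have "q a \<le> q (t *\<^sub>R a) / t" using le[of "inverse t" "t *\<^sub>R a"] t by (simp add: field_simps)
    with le[OF t, of a] t show ?thesis by (simp add: field_simps)
  qed (simp add: q0)
  with add have "sublinear_fn q" by (auto simp: sublinear_fn_def)
  moreover have "q x \<le> p x" for x using q_le[of 0 x] by (simp add: h_def)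
  moreover have "q (- y) \<le> - p y" using q_le[of 1 "- y"] sublinear_fn_neg[OF p] by (simp add: h_def)
  ultimately show ?thesis by blast
qed

text \<open>Hahn--Banach: a minimal sublinear functional is odd, hence linear, by the preceding lemma.\<close>

lemma linear_below_sublinear_fn:
  fixes p :: "'a::real_vector \<Rightarrow> real"
  assumes p: "sublinear_fn p"
  shows "\<exists>f. linear f \<and> (\<forall>x. f x \<le> p x)"
proof -
  define A where "A = {q. sublinear_fn q \<and> (\<forall>x. q x \<le> p x)}"
  \<comment> \<open>The order is reversed, so a maximal element in Zorn's lemma is a pointwise
    minimal functional.\<close>
  define P where "P = (\<lambda>q q' :: 'a \<Rightarrow> real. \<forall>x. q' x \<le> q x)"
  have po: "partial_order_on A (relation_of P A)"
    unfolding partial_order_on_def preorder_on_def refl_on_def trans_def antisym_def relation_of_def P_def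
    by (auto intro!: ext order.antisym intro: order.trans)
  have ub: "\<exists>u\<in>A. \<forall>a\<in>C. P a u" if C: "C \<in> Chains (relation_of P A)" for C
  proof (cases "C = {}")
    case True
    then show ?thesis using p by (auto simp: A_def)
  next
    case False
    have CA: "sublinear_fn q" "q x \<le> p x" if "q \<in> C" for q x
      using C that by (auto simp: Chains_def relation_of_def A_def)
    have cmp: "P q q' \<or> P q' q" if "q \<in> C" "q' \<in> C" for q q'
      using C that by (auto simp: Chains_def relation_of_def)
    have lower: "- p (- x) \<le> q x" if "q \<in> C" for q x
      using sublinear_fn_neg(2)[OF CA(1)[OF that], of x] CA(2)[OF that, of "- x"] by simp
    define u where "u x = (INF q\<in>C. q x)" for x
    have bdd: "bdd_below ((\<lambda>q. q x) ` C)" for x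
      using lower by (auto intro!: bdd_belowI2[where m = "- p (- x)"])
    have u_le: "u x \<le> q x" if "q \<in> C" for x q
      unfolding u_def using that by (intro cINF_lower bdd) auto
    have u_ge: "c \<le> u x" if "\<And>q. q \<in> C \<Longrightarrow> c \<le> q x" for c x
      unfolding u_def using that False by (intro cINF_greatest) auto
    have add: "u (a + b) \<le> u a + u b" for a b
    proof -
      \<comment> \<open>An infimum of sublinear functionals need not be subadditive; in a chain the
        smaller of \<open>q\<close> and \<open>q'\<close> can be used for both arguments.\<close>
      have *: "u (a + b) \<le> q a + q' b" if qq: "q \<in> C" "q' \<in> C" for q q'
      proof -
        have sub: "r (a + b) \<le> r a + r b" if "r \<in> C" for r
          using CA(1)[OF that] by (auto simp: sublinear_fn_def)
        from cmp[OF qq] show ?thesis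
        proof
          assume "P q q'"
          then have "q' a \<le> q a" by (auto simp: P_def)
          then show ?thesis using u_le[OF qq(2), of "a + b"] sub[OF qq(2)] by simp
        next
          assume "P q' q"
          then have "q b \<le> q' b" by (auto simp: P_def)
          then show ?thesis using u_le[OF qq(1), of "a + b"] sub[OF qq(1)] by simp
        qed
      qed
      have "u (a + b) - q a \<le> u b" if "q \<in> C" for q
        using *[OF that] by (intro u_ge) (simp add: algebra_simps)
      then have "u (a + b) - u b \<le> u a"
        by (intro u_ge) (simp add: algebra_simps)
      then show ?thesis by simp
    qed
    have hom: "u (t *\<^sub>R a) = t * u a" if t: "0 \<le> t" for t a
    proof -
      have homC: "q (t *\<^sub>R a) = t * q a" if "q \<in> C" for q
        using CA(1)[OF that] t by (auto simp: sublinear_fn_def)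
      show ?thesis
      proof (cases "t = 0")
        case True
        have "u 0 = 0"
        proof -
          obtain q where q: "q \<in> C" using \<open>C \<noteq> {}\<close> by blast
          have "u 0 \<le> 0" using u_le[OF q, of 0] sublinear_fn_neg(1)[OF CA(1)[OF q]] by simp
          moreover have "0 \<le> u 0" using sublinear_fn_neg(1)[OF CA(1)] by (intro u_ge) fastforce
          ultimately show ?thesis by simp
        qed
        with True show ?thesis by simp
      next
        case False
        with t have t: "0 < t" by simp
        have "u (t *\<^sub>R a) / t \<le> u a"
          using u_le[of _ "t *\<^sub>R a"] homC t by (intro u_ge) (simp add: field_simps)
        moreover have "t * u a \<le> u (t *\<^sub>R a)"
          using u_le[of _ a] homC t by (intro u_ge) (metis mult_left_mono less_imp_le)
        ultimately show ?thesis using t by (simp add: field_simps)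
      qed
    qed
    have "u x \<le> p x" for x
      using False u_le[of _ x] CA(2)[of _ x] by (meson ex_in_conv order.trans)
    then have "u \<in> A" using add hom by (auto simp: A_def sublinear_fn_def)
    then show ?thesis using u_le by (auto simp: P_def)
  qed
  from predicate_Zorn[OF po ub] obtain f where f: "f \<in> A" and
    min: "\<And>q. q \<in> A \<Longrightarrow> P f q \<Longrightarrow> q = f" by blast
  have sf: "sublinear_fn f" and fp: "\<And>x. f x \<le> p x" using f by (auto simp: A_def)
  have neg: "f (- y) = - f y" for y
  proof -
    obtain q where q: "sublinear_fn q" "\<And>x. q x \<le> f x" "q (- y) \<le> - f y"
      using sublinear_fn_reduce[OF sf] by blast
    then have "q = f" using fp by (intro min) (auto simp: A_def P_def intro: order.trans)
    then show ?thesis using q(3) sublinear_fn_neg(2)[OF sf, of y] by simp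
  qed
  have "linear f"
  proof
    fix a b :: 'a and r :: real
    have sub: "f (x + y) \<le> f x + f y" for x y using sf by (auto simp: sublinear_fn_def)
    have hom: "0 \<le> t \<Longrightarrow> f (t *\<^sub>R x) = t * f x" for t x using sf by (auto simp: sublinear_fn_def)
    show "f (a + b) = f a + f b"
      using sub[of a b] sub[of "- a" "- b"] neg[of "a + b"] neg[of a] neg[of b] by simp
    show "f (r *\<^sub>R a) = r *\<^sub>R f a"
      using hom[of r a] hom[of "- r" a] neg[of "r *\<^sub>R a"] by (cases "0 \<le> r") auto
  qed
  with fp show ?thesis by blast
qed

text \<open>A linear functional below the reduced norm \<open>q\<close> satisfies
  \<open>- f y = f (- y) \<le> q (- y) \<le> - norm y\<close>, hence attains the norm at
  \<open>y\<close>. This replaces extending a functional from the line through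
  \<open>y\<close>.\<close>

lemma norming_functional_exists:
  fixes y :: "'a::real_normed_vector"
  shows "\<exists>f. bounded_linear f \<and> (\<forall>x. \<bar>f x\<bar> \<le> norm x) \<and> f y = norm y"
proof -
  have "sublinear_fn (norm :: 'a \<Rightarrow> real)" by (auto simp: sublinear_fn_def norm_triangle_ineq)
  then obtain q where q: "sublinear_fn q" "\<And>x. q x \<le> norm x" "q (- y) \<le> - norm y"
    using sublinear_fn_reduce by blast
  obtain f where f: "linear f" "\<And>x. f x \<le> q x" using linear_below_sublinear_fn[OF q(1)] by blast
  have le: "f x \<le> norm x" for x using f(2) q(2) order.trans by blast
  have neg: "f (- x) = - f x" for x using f(1) by (simp add: linear_neg)
  have abs: "\<bar>f x\<bar> \<le> norm x" for x using le[of x] le[of "- x"] neg[of x] by (simp add: abs_le_iff)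
  have "f y = norm y" using le[of y] f(2)[of "- y"] q(3) neg[of y] by simp
  moreover have "bounded_linear f"
    using f(1) abs by (auto intro!: bounded_linear_intro[where K = 1] simp: linear_add linear_scale)
  ultimately show ?thesis using abs by blast
qed

section \<open>Singular values of triangular matrices\<close>

text \<open>Vectors of R^N are functions on \<open>nat\<close> of which only the values below
  \<open>N\<close> are read, since the dimension \<open>N\<close> is a variable and not a
  type.\<close>

definition dot :: "nat \<Rightarrow> (nat \<Rightarrow> real) \<Rightarrow> (nat \<Rightarrow> real) \<Rightarrow> real" where
  "dot N x y = (\<Sum>i<N. x i * y i)"

definition mapp :: "nat \<Rightarrow> (nat \<Rightarrow> nat \<Rightarrow> real) \<Rightarrow> (nat \<Rightarrow> real) \<Rightarrow> nat \<Rightarrow> real" where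
  "mapp N T x i = (\<Sum>j<N. T i j * x j)"

definition orthonormal_fam :: "nat \<Rightarrow> (nat \<Rightarrow> nat \<Rightarrow> real) \<Rightarrow> nat \<Rightarrow> bool" where
  "orthonormal_fam N v j \<longleftrightarrow> (\<forall>l<j. \<forall>m<j. dot N (v l) (v m) = (if l = m then 1 else 0))"

lemma dot_commute: "dot N x y = dot N y x"
  by (simp add: dot_def mult.commute)

lemma dot_add_scale: "dot N (\<lambda>i. x i + t * y i) (\<lambda>i. x i + t * y i)
    = dot N x x + 2 * t * dot N x y + t\<^sup>2 * dot N y y"
  by (simp add: dot_def algebra_simps power2_eq_square sum.distrib sum_distrib_left)

lemma dot_add_scale_left: "dot N (\<lambda>i. x i + t * y i) z = dot N x z + t * dot N y z"
  by (simp add: dot_def algebra_simps sum.distrib sum_distrib_left)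

lemma mapp_add_scale: "mapp N T (\<lambda>i. x i + t * y i) = (\<lambda>i. mapp N T x i + t * mapp N T y i)"
  by (simp add: mapp_def algebra_simps sum.distrib sum_distrib_left fun_eq_iff)

lemma dot_nonneg: "0 \<le> dot N x x"
  by (simp add: dot_def sum_nonneg)

text \<open>The coefficients \<open>c\<close> are left free: the Fourier coefficients of
  \<open>x\<close> give Bessel's inequality, and \<open>x = 0\<close> gives Parseval's identity for
  combinations of the \<open>v l\<close>.\<close>

lemma dot_diff_proj:
  assumes "orthonormal_fam N v j"
  shows "dot N (\<lambda>i. x i - (\<Sum>l<j. c l * v l i)) (\<lambda>i. x i - (\<Sum>l<j. c l * v l i))
    = dot N x x - 2 * (\<Sum>l<j. c l * dot N x (v l)) + (\<Sum>l<j. (c l)\<^sup>2)"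
proof -
  have 1: "dot N x (\<lambda>i. \<Sum>l<j. c l * v l i) = (\<Sum>l<j. c l * dot N x (v l))" for x
    unfolding dot_def sum_distrib_left by (subst sum.swap) (simp add: algebra_simps)
  have 2: "dot N (\<lambda>i. \<Sum>l<j. c l * v l i) (\<lambda>i. \<Sum>l<j. c l * v l i) = (\<Sum>l<j. (c l)\<^sup>2)"
  proof -
    have "dot N (\<lambda>i. \<Sum>l<j. c l * v l i) (v m) = c m" if "m < j" for m
    proof -
      have "dot N (\<lambda>i. \<Sum>l<j. c l * v l i) (v m) = (\<Sum>l<j. c l * dot N (v m) (v l))"
        using 1[of "v m"] by (simp add: dot_commute)
      also have "\<dots> = (\<Sum>l<j. if m = l then c l else 0)"
        using assms that by (intro sum.cong) (auto simp: orthonormal_fam_def)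
      finally show ?thesis using that by simp
    qed
    then show ?thesis by (subst 1) (auto simp: power2_eq_square)
  qed
  have "dot N (\<lambda>i. x i - y i) (\<lambda>i. x i - y i) = dot N x x - 2 * dot N x y + dot N y y" for y
    using dot_add_scale[of N x "-1" y] by simp
  from this[of "\<lambda>i. \<Sum>l<j. c l * v l i"] show ?thesis by (simp only: 2 1[of x])
qed

lemma bessel_fam:
  assumes "orthonormal_fam N v j"
  shows "(\<Sum>l<j. (dot N x (v l))\<^sup>2) \<le> dot N x x"
proof -
  have "0 \<le> dot N (\<lambda>i. x i - (\<Sum>l<j. dot N x (v l) * v l i)) (\<lambda>i. x i - (\<Sum>l<j. dot N x (v l) * v l i))"
    by (rule dot_nonneg)
  then show ?thesis by (subst (asm) dot_diff_proj[OF assms]) (simp add: power2_eq_square)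
qed

text \<open>A trace count: the squared lengths of the projections of the \<open>N\<close> standard
  basis vectors onto the span of the \<open>v l\<close> add up to \<open>j < N\<close>, so some
  \<open>e a\<close> has a projection shorter than 1. Its residual is nonzero and orthogonal to
  every \<open>v l\<close>.\<close>

lemma unit_vector_orthogonal_exists:
  assumes v: "orthonormal_fam N v j" and j: "j < N"
  shows "\<exists>x. (\<forall>i\<ge>N. x i = 0) \<and> dot N x x = 1 \<and> (\<forall>l<j. dot N x (v l) = 0)"
proof -
  define e :: "nat \<Rightarrow> nat \<Rightarrow> real" where "e a i = (if i = a then 1 else 0)" for a i
  have e: "dot N (e a) y = y a" if "a < N" for a y
    using that by (simp add: dot_def e_def if_distrib[of "\<lambda>z. z * _"] cong: if_cong)
  have "(\<Sum>a<N. \<Sum>l<j. (v l a)\<^sup>2) = (\<Sum>l<j. dot N (v l) (v l))"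
    unfolding dot_def by (subst sum.swap) (simp add: power2_eq_square)
  also have "\<dots> = real j" using v by (simp add: orthonormal_fam_def)
  also have "\<dots> < (\<Sum>a<N. 1)" using j by simp
  finally have less: "(\<Sum>a<N. \<Sum>l<j. (v l a)\<^sup>2) < (\<Sum>a<N. 1)" .
  have "\<exists>a<N. (\<Sum>l<j. (v l a)\<^sup>2) < 1"
  proof (rule ccontr)
    assume "\<not> (\<exists>a<N. (\<Sum>l<j. (v l a)\<^sup>2) < 1)"
    then have "(\<Sum>a<N. 1) \<le> (\<Sum>a<N. \<Sum>l<j. (v l a)\<^sup>2)"
      by (intro sum_mono) (metis lessThan_iff not_less)
    with less show False by simp
  qed
  then obtain a where a: "a < N" "(\<Sum>l<j. (v l a)\<^sup>2) < 1" by blast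
  \<comment> \<open>The cut-off at \<open>N\<close> leaves inner products unchanged; it places the
    normalized vector in the compact set over which a maximum is taken later.\<close>
  define w where "w i = (if i < N then e a i - (\<Sum>l<j. v l a * v l i) else 0)" for i
  have dw: "dot N w y = dot N (\<lambda>i. e a i - (\<Sum>l<j. v l a * v l i)) y"
       "dot N y w = dot N y (\<lambda>i. e a i - (\<Sum>l<j. v l a * v l i))" for y
    by (auto simp: dot_def w_def)
  have "dot N w w = 1 - (\<Sum>l<j. (v l a)\<^sup>2)"
    unfolding dw using dot_diff_proj[OF v, of "e a" "\<lambda>l. v l a"] a
    by (simp add: e) (simp add: e_def power2_eq_square)
  with a have pos: "0 < dot N w w" by simp
  have orth: "dot N w (v m) = 0" if "m < j" for m
  proof -
    have "dot N w (v m) = dot N (e a) (v m) - (\<Sum>l<j. v l a * dot N (v l) (v m))"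
      unfolding dw by (simp add: dot_def algebra_simps sum_subtractf sum_distrib_left) (rule sum.swap)
    also have "(\<Sum>l<j. v l a * dot N (v l) (v m)) = (\<Sum>l<j. if m = l then v l a else 0)"
      using v that by (intro sum.cong) (auto simp: orthonormal_fam_def)
    finally show ?thesis using that a by (simp add: e)
  qed
  have sc: "dot N (\<lambda>i. w i / c) y = dot N w y / c" "dot N y (\<lambda>i. w i / c) = dot N y w / c" for c y
    by (simp_all add: dot_def sum_divide_distrib)
  have "dot N (\<lambda>i. w i / sqrt (dot N w w)) (\<lambda>i. w i / sqrt (dot N w w)) = 1"
    using pos by (simp add: sc)
  moreover have "\<forall>i\<ge>N. w i = 0" by (simp add: w_def)
  ultimately show ?thesis
    using orth by (intro exI[of _ "\<lambda>i. w i / sqrt (dot N w w)"]) (auto simp: sc)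
qed

lemma continuous_on_coordinate [continuous_intros]: "continuous_on A (\<lambda>x::nat \<Rightarrow> real. x i)"
  by (rule continuous_on_subset[OF continuous_on_product_coordinates]) auto

text \<open>With the coordinates from \<open>N\<close> on fixed to zero this is a closed subset of a
  product of compact intervals and points, which is compact by Tychonoff's theorem.\<close>

lemma compact_unit_sphere_orthogonal:
  "compact {x. (\<forall>i\<ge>N. x i = 0) \<and> dot N x x = 1 \<and> (\<forall>l<j. dot N x (v l) = 0)}" (is "compact ?K")
proof -
  define C where "C = PiE UNIV (\<lambda>i. if i < N then {-1..1} else {0::real})"
  have "compactin (product_topology (\<lambda>i::nat. euclidean::real topology) UNIV) C"
    unfolding C_def by (subst compactin_PiE) auto
  then have C: "compact C"
    by (simp add: euclidean_product_topology)
  have cont: "continuous_on UNIV (\<lambda>x. dot N x (f x))" if "\<And>i. continuous_on UNIV (\<lambda>x. f x i)"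
    for f :: "(nat \<Rightarrow> real) \<Rightarrow> nat \<Rightarrow> real"
    unfolding dot_def using that by (intro continuous_intros) 
  have "?K = (\<Inter>i\<in>{N..}. {x. x i = 0}) \<inter> {x. dot N x x = 1} \<inter> (\<Inter>l\<in>{..<j}. {x. dot N x (v l) = 0})"
    by auto
  also have "closed \<dots>"
    by (intro closed_Int closed_INT ballI closed_Collect_eq cont continuous_intros)
  finally have cl: "closed ?K" .
  have "?K \<subseteq> C"
  proof
    fix x assume x: "x \<in> ?K"
    have "x i \<in> {-1..1}" if "i < N" for i
    proof -
      have "(x i)\<^sup>2 \<le> (\<Sum>i<N. (x i)\<^sup>2)" using that by (intro member_le_sum) auto
      also have "\<dots> = 1" using x by (simp add: dot_def power2_eq_square)
      finally show ?thesis by (simp add: abs_square_le_1 abs_le_iff) 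
    qed
    then show "x \<in> C" using x by (auto simp: C_def PiE_def)
  qed
  then have "?K = C \<inter> ?K" by blast
  also have "compact \<dots>" by (rule compact_Int_closed[OF C cl])
  finally show ?thesis .
qed

text \<open>Right singular vectors by successive maximization: \<open>v l\<close> maximizes the
  length of \<open>T x\<close> on the unit sphere of the complement of its predecessors. The bound
  is homogeneous in \<open>x\<close>, so that it can be tested on vectors that are not
  normalized.\<close>

lemma maximizing_orthonormal_fam:
  assumes "j \<le> N"
  shows "\<exists>v. orthonormal_fam N v j \<and> (\<forall>l<j. \<forall>x. (\<forall>m<l. dot N x (v m) = 0) \<longrightarrow>
      dot N (mapp N T x) (mapp N T x) \<le> dot N (mapp N T (v l)) (mapp N T (v l)) * dot N x x)"
  using assms
proof (induction j)
  case 0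
  then show ?case by (auto simp: orthonormal_fam_def)
next
  case (Suc j)
  then obtain v where v: "orthonormal_fam N v j" and
    vmax: "\<And>l x. l < j \<Longrightarrow> (\<And>m. m < l \<Longrightarrow> dot N x (v m) = 0) \<Longrightarrow>
      dot N (mapp N T x) (mapp N T x) \<le> dot N (mapp N T (v l)) (mapp N T (v l)) * dot N x x"
    by auto
  define K where "K = {x. (\<forall>i\<ge>N. x i = 0) \<and> dot N x x = 1 \<and> (\<forall>l<j. dot N x (v l) = 0)}"
  define q where "q x = dot N (mapp N T x) (mapp N T x)" for x
  have "compact K" unfolding K_def by (rule compact_unit_sphere_orthogonal)
  moreover have "K \<noteq> {}" using unit_vector_orthogonal_exists[OF v] Suc.prems by (auto simp: K_def)
  moreover have "continuous_on K q"
    unfolding q_def dot_def mapp_def by (intro continuous_intros)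
  ultimately obtain u where u: "u \<in> K" and umax: "\<And>x. x \<in> K \<Longrightarrow> q x \<le> q u"
    using continuous_attains_sup[of K q] by auto
  have q_le: "q x \<le> q u * dot N x x" if orth: "\<And>m. m < j \<Longrightarrow> dot N x (v m) = 0" for x
  proof (cases "dot N x x = 0")
    case True
    then have "\<forall>i<N. x i = 0"
      by (auto simp: dot_def sum_nonneg_eq_0_iff)
    then have "q x = 0" by (simp add: q_def mapp_def dot_def)
    with True show ?thesis by simp
  next
    case False
    then have pos: "0 < dot N x x" using dot_nonneg[of N x] by simp
    define c where "c = sqrt (dot N x x)"
    have c: "c > 0" "c * c = dot N x x" using pos by (auto simp: c_def)
    define y where "y i = (if i < N then x i / c else 0)" for i
    have y: "dot N y z = dot N x z / c" "dot N z y = dot N x z / c" for z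
      by (auto simp: dot_def y_def sum_divide_distrib algebra_simps)
    have "y \<in> K" using orth c by (auto simp: K_def y) (auto simp: y_def dot_commute)
    moreover have "mapp N T y = (\<lambda>i. mapp N T x i / c)"
      by (auto simp: mapp_def y_def sum_divide_distrib fun_eq_iff)
    then have "q y = q x / (c * c)"
      by (simp add: q_def dot_def sum_divide_distrib)
    ultimately show ?thesis using umax[of y] c pos by (simp add: pos_divide_le_eq)
  qed
  have u': "dot N u u = 1" "\<And>l. l < j \<Longrightarrow> dot N u (v l) = 0" "\<And>l. l < j \<Longrightarrow> dot N (v l) u = 0"
    using u by (auto simp: K_def dot_commute)
  have "orthonormal_fam N (v(j := u)) (Suc j)"
    using v u' by (auto simp: orthonormal_fam_def less_Suc_eq)
  moreover have "q x \<le> q ((v(j := u)) l) * dot N x x"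
    if "l < Suc j" and "\<forall>m<l. dot N x ((v(j := u)) m) = 0" for l x
    using that vmax[of l x] q_le[of x] by (cases "l = j") (auto simp: q_def)
  ultimately show ?case unfolding q_def by blast
qed

text \<open>First variation at the maximizer: moving \<open>v l\<close> by \<open>t\<close> in the
  direction \<open>v k\<close> gives \<open>2 t a \<le> t^2 b\<close> for every real
  \<open>t\<close>, which forces the cross term \<open>a\<close> to vanish.\<close>

lemma orthogonal_images_of_maximizer:
  assumes max: "\<And>x. (\<And>m. m < l \<Longrightarrow> dot N x (v m) = 0) \<Longrightarrow>
      dot N (mapp N T x) (mapp N T x) \<le> dot N (mapp N T (v l)) (mapp N T (v l)) * dot N x x"
    and v: "orthonormal_fam N v j" and lk: "l < k" "k < j"
  shows "dot N (mapp N T (v l)) (mapp N T (v k)) = 0"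
proof -
  define a where "a = dot N (mapp N T (v l)) (mapp N T (v k))"
  define b where "b = dot N (mapp N T (v l)) (mapp N T (v l))"
  have vv: "\<And>m. m < j \<Longrightarrow> dot N (v m) (v m) = 1"
       "\<And>m m'. m < j \<Longrightarrow> m' < j \<Longrightarrow> m \<noteq> m' \<Longrightarrow> dot N (v m) (v m') = 0"
    using v by (auto simp: orthonormal_fam_def)
  have le: "2 * t * a \<le> t\<^sup>2 * b" for t
  proof -
    define x where "x i = v l i + t * v k i" for i
    have "dot N x (v m) = 0" if "m < l" for m
      unfolding x_def dot_add_scale_left using vv that lk by simp
    from max[OF this] have "dot N (mapp N T x) (mapp N T x) \<le> b * dot N x x"
      by (simp add: b_def)
    moreover have "dot N x x = 1 + t\<^sup>2"
      unfolding x_def dot_add_scale using vv lk by simp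
    moreover have "dot N (mapp N T x) (mapp N T x) = b + 2 * t * a + t\<^sup>2 * dot N (mapp N T (v k)) (mapp N T (v k))"
      unfolding x_def mapp_add_scale dot_add_scale by (simp add: a_def b_def)
    moreover have "0 \<le> t\<^sup>2 * dot N (mapp N T (v k)) (mapp N T (v k))"
      by (simp add: dot_nonneg)
    ultimately show ?thesis by (simp add: algebra_simps)
  qed
  have b0: "0 \<le> b" by (simp add: b_def dot_nonneg)
  \<comment> \<open>This choice turns the inequality into \<open>t^2 (b + 2) \<le> 0\<close>; the
    denominator \<open>b + 1\<close> stays valid when \<open>b = 0\<close>.\<close>
  define t where "t = a / (b + 1)"
  have a: "a = t * (b + 1)" using b0 by (simp add: t_def)
  have "t\<^sup>2 * (b + 2) \<le> 0" using le[of t] by (simp add: a algebra_simps power2_eq_square)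
  then have "t = 0" using b0 by (simp add: mult_le_0_iff)
  then have "a = 0" using a by simp
  then show ?thesis by (simp add: a_def)
qed

text \<open>With \<open>V\<close> the orthogonal matrix of the maximizers and
  \<open>W = T V\<close>, the Gram matrix of the columns of \<open>W\<close> is diagonal, with the
  squared singular values as entries, and its determinant is \<open>(det T)^2\<close>. Triangularity
  evaluates \<open>det T\<close>.\<close>

lemma singular_value_decomposition_lower_triangular:
  assumes tri: "\<And>i j. i < j \<Longrightarrow> j < N \<Longrightarrow> T i j = 0"
  shows "\<exists>v. orthonormal_fam N v N
    \<and> (\<forall>l<N. \<forall>m<N. l \<noteq> m \<longrightarrow> dot N (mapp N T (v l)) (mapp N T (v m)) = 0)
    \<and> (\<forall>l m. l \<le> m \<longrightarrow> m < N \<longrightarrow> dot N (mapp N T (v m)) (mapp N T (v m)) \<le> dot N (mapp N T (v l)) (mapp N T (v l)))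
    \<and> (\<Prod>j<N. dot N (mapp N T (v j)) (mapp N T (v j))) = (\<Prod>j<N. (T j j)\<^sup>2)"
proof -
  obtain v where v: "orthonormal_fam N v N" and
    max: "\<And>l x. l < N \<Longrightarrow> (\<And>m. m < l \<Longrightarrow> dot N x (v m) = 0) \<Longrightarrow>
      dot N (mapp N T x) (mapp N T x) \<le> dot N (mapp N T (v l)) (mapp N T (v l)) * dot N x x"
    using maximizing_orthonormal_fam[of N N T] by auto
  have vv: "\<And>l m. l < N \<Longrightarrow> m < N \<Longrightarrow> dot N (v l) (v m) = (if l = m then 1 else 0)"
    using v by (auto simp: orthonormal_fam_def)
  have orth: "dot N (mapp N T (v l)) (mapp N T (v m)) = 0" if "l < N" "m < N" "l \<noteq> m" for l m
  proof -
    have *: "dot N (mapp N T (v l)) (mapp N T (v m)) = 0" if "l < m" "m < N" for l m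
      using that by (intro orthogonal_images_of_maximizer[OF max v]) auto
    show ?thesis using that *[of l m] *[of m l] dot_commute by (metis linorder_neqE_nat)
  qed
  have mono: "dot N (mapp N T (v m)) (mapp N T (v m)) \<le> dot N (mapp N T (v l)) (mapp N T (v l))"
    if "l \<le> m" "m < N" for l m
    using max[of l "v m"] vv that by simp
  define A where "A = mat N N (\<lambda>(i, j). T i j)"
  define V where "V = mat N N (\<lambda>(i, j). v j i)"
  have AV: "A \<in> carrier_mat N N" "V \<in> carrier_mat N N" by (auto simp: A_def V_def)
  have VV: "transpose_mat V * V = 1\<^sub>m N"
    using vv by (intro eq_matI) (auto simp: V_def scalar_prod_def dot_def atLeast0LessThan)
  have dV: "det V * det V = 1"
    using arg_cong[OF VV, of det] AV by (simp add: det_mult[of _ N] det_transpose[of _ N])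
  define W where "W = A * V"
  have W: "W \<in> carrier_mat N N" using AV by (auto simp: W_def)
  have Wi: "W $$ (i, j) = mapp N T (v j) i" if "i < N" "j < N" for i j
    using that by (simp add: W_def A_def V_def scalar_prod_def mapp_def atLeast0LessThan)
  define D where "D = transpose_mat W * W"
  have Dc: "D \<in> carrier_mat N N" using W by (auto simp: D_def)
  have Dij: "D $$ (i, j) = dot N (mapp N T (v i)) (mapp N T (v j))" if "i < N" "j < N" for i j
    using that W Wi by (simp add: D_def scalar_prod_def atLeast0LessThan dot_def)
  have "det D = (\<Prod>j<N. dot N (mapp N T (v j)) (mapp N T (v j)))"
    using det_lower_triangular[of N D] Dc Dij orth
    by (simp add: prod_list_diag_prod atLeast0LessThan)
  moreover have "det D = (det A)\<^sup>2"
    using AV W dV by (simp add: D_def W_def det_mult[of _ N] det_transpose[of _ N] power2_eq_square)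
  moreover have "det A = (\<Prod>j<N. T j j)"
    using det_lower_triangular[of N A] tri AV
    by (simp add: prod_list_diag_prod atLeast0LessThan) (simp add: A_def)
  ultimately show ?thesis using v orth mono by (auto simp: prod_power_distrib)
qed

section \<open>A family of weights on Euclidean balls\<close>

text \<open>The moment identity is the integral of the derivative of
  \<open>u (1 - u^2)^(b + 1)\<close>, a function vanishing at both endpoints. The range of
  \<open>b\<close> starts at -1/2 because this is the exponent that belongs to dimension 0.\<close>

lemma beta_kernel_integral:
  fixes b :: real
  assumes b: "-1/2 \<le> b"
  shows "\<exists>\<kappa>>0. (\<integral>\<^sup>+u. (if u\<^sup>2 < 1 then ennreal ((1 - u\<^sup>2) powr b) else 0) \<partial>lborel) = ennreal \<kappa>
    \<and> ennreal (2 * b + 3) * (\<integral>\<^sup>+u. ennreal (u\<^sup>2) * (if u\<^sup>2 < 1 then ennreal ((1 - u\<^sup>2) powr b) else 0) \<partial>lborel) = ennreal \<kappa>"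
proof -
  define E :: "real set" where "E = {-1<..<1}"
  have sq: "u\<^sup>2 < 1 \<longleftrightarrow> u \<in> E" for u :: real
    using abs_square_less_1[of u] by (auto simp: E_def)
  \<comment> \<open>The case \<open>b = -1/2\<close> is unbounded at both endpoints, but it is the
    derivative of \<open>arcsin\<close>; it dominates all larger exponents because
    \<open>0 < 1 - u^2 \<le> 1\<close>.\<close>
  have inv_int: "set_integrable lborel E (\<lambda>u. inverse (sqrt (1 - u\<^sup>2)))"
  proof -
    have "set_integrable lborel (einterval (ereal (-1)) (ereal 1)) (\<lambda>u. inverse (sqrt (1 - u\<^sup>2)))"
    proof (rule interval_integral_FTC_nonneg(1)[where F = arcsin and A = "arcsin (-1)" and B = "arcsin 1"])
      show "DERIV arcsin x :> inverse (sqrt (1 - x\<^sup>2))" if "ereal (-1) < ereal x" "ereal x < ereal 1" for x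
        using that by (intro DERIV_arcsin) auto
      show "isCont (\<lambda>u. inverse (sqrt (1 - u\<^sup>2))) x" if "ereal (-1) < ereal x" "ereal x < ereal 1" for x
      proof -
        have "x\<^sup>2 < 1" using that by (simp add: sq E_def)
        then show ?thesis by (intro continuous_intros) auto
      qed
      show "AE x in lborel. ereal (-1) < ereal x \<longrightarrow> ereal x < ereal 1 \<longrightarrow> 0 \<le> inverse (sqrt (1 - x\<^sup>2))"
        by (auto simp: sq E_def intro!: AE_I2 less_imp_le)
      have c: "continuous_on {-1..1} arcsin" by (rule continuous_on_arcsin')
      show "((arcsin \<circ> real_of_ereal) \<longlongrightarrow> arcsin (-1)) (at_right (ereal (-1)))"
        unfolding ereal_tendsto_simps by (rule continuous_on_Icc_at_rightD[OF c]) simp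
      show "((arcsin \<circ> real_of_ereal) \<longlongrightarrow> arcsin 1) (at_left (ereal 1))"
        unfolding ereal_tendsto_simps by (rule continuous_on_Icc_at_leftD[OF c]) simp
    qed simp
    then show ?thesis by (simp add: E_def)
  qed
  have le: "(1 - u\<^sup>2) powr b \<le> inverse (sqrt (1 - u\<^sup>2))" if "u \<in> E" for u
  proof -
    have "0 < 1 - u\<^sup>2" "1 - u\<^sup>2 \<le> 1" using that sq[of u] by auto
    then have "(1 - u\<^sup>2) powr b \<le> (1 - u\<^sup>2) powr (-1/2)" using b by (intro powr_mono') auto
    also have "\<dots> = inverse (sqrt (1 - u\<^sup>2))"
      using \<open>0 < 1 - u\<^sup>2\<close> by (simp add: powr_minus powr_half_sqrt[symmetric])
    finally show ?thesis .
  qed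
  have le': "(1 - u\<^sup>2) powr b \<le> inverse \<bar>sqrt (1 - u\<^sup>2)\<bar>" if "u \<in> E" for u
    using le[OF that] that by (simp add: sq[symmetric])
  define f1 where "f1 u = indicator E u * (1 - u\<^sup>2) powr b" for u
  define f2 where "f2 u = u\<^sup>2 * f1 u" for u
  have [measurable]: "E \<in> sets borel" by (simp add: E_def)
  have [measurable]: "f1 \<in> borel_measurable borel" "f2 \<in> borel_measurable borel"
    unfolding f1_def f2_def by measurable
  have nn: "0 \<le> f1 u" "0 \<le> f2 u" for u by (auto simp: f1_def f2_def)
  have i1: "integrable lborel f1"
    using inv_int unfolding set_integrable_def
    by (rule Bochner_Integration.integrable_bound) (auto simp: f1_def indicator_def intro!: AE_I2 le')
  have i2: "integrable lborel f2"
    using i1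
    by (rule Bochner_Integration.integrable_bound)
       (auto simp: f1_def f2_def sq[symmetric] indicator_def mult_left_le_one_le less_imp_le)
  have parts: "(LINT u|lborel. f1 u - (2 * b + 3) * f2 u) = 0"
  proof -
    define F where "F u = u * (1 - u\<^sup>2) powr (b + 1)" for u :: real
    define f where "f u = (1 - u\<^sup>2) powr b - (2 * b + 3) * (u\<^sup>2 * (1 - u\<^sup>2) powr b)" for u
    have eq: "f1 u - (2 * b + 3) * f2 u = indicator E u *\<^sub>R f u" for u
      by (simp add: f1_def f2_def f_def indicator_def)
    have "(LBINT u=ereal (-1)..ereal 1. f u) = F 1 - F (-1)"
    proof (rule interval_integral_FTC_integrable)
      show "(F has_vector_derivative f x) (at x)" if "ereal (-1) < ereal x" "ereal x < ereal 1" for x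
      proof -
        have x: "0 < 1 - x\<^sup>2" using that sq[of x] by (auto simp: E_def)
        have "(F has_real_derivative (1 - x\<^sup>2) powr (b + 1) - x * ((b + 1) * (1 - x\<^sup>2) powr b * (2 * x))) (at x)"
          unfolding F_def using x by (auto intro!: derivative_eq_intros simp: algebra_simps)
        moreover have "(1 - x\<^sup>2) powr (b + 1) = (1 - x\<^sup>2) * (1 - x\<^sup>2) powr b"
          using x by (simp add: powr_add)
        then have "(1 - x\<^sup>2) powr (b + 1) - x * ((b + 1) * (1 - x\<^sup>2) powr b * (2 * x)) = f x"
          by (simp add: f_def algebra_simps power2_eq_square)
        ultimately show ?thesis by (simp add: has_real_derivative_iff_has_vector_derivative)
      qed
      show "isCont f x" if "ereal (-1) < ereal x" "ereal x < ereal 1" for x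
      proof -
        have "0 < 1 - x\<^sup>2" using that sq[of x] by (auto simp: E_def)
        then show ?thesis unfolding f_def by (intro continuous_intros) auto
      qed
      have "integrable lborel (\<lambda>u. f1 u - (2 * b + 3) * f2 u)" using i1 i2 by auto
      then show "set_integrable lborel (einterval (ereal (-1)) (ereal 1)) f"
        by (simp add: set_integrable_def eq E_def)
      have c: "continuous_on {-1..1} F" unfolding F_def using b
        by (intro continuous_on_mult continuous_on_powr' continuous_intros)
           (auto simp: abs_square_le_1 abs_le_iff)
      show "((F \<circ> real_of_ereal) \<longlongrightarrow> F (-1)) (at_right (ereal (-1)))"
        unfolding ereal_tendsto_simps by (rule continuous_on_Icc_at_rightD[OF c]) simp
      show "((F \<circ> real_of_ereal) \<longlongrightarrow> F 1) (at_left (ereal 1))"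
        unfolding ereal_tendsto_simps by (rule continuous_on_Icc_at_leftD[OF c]) simp
    qed simp
    then have "(LBINT u=ereal (-1)..ereal 1. f u) = 0" by (simp add: F_def)
    then show ?thesis
      by (simp add: interval_lebesgue_integral_def set_lebesgue_integral_def eq E_def)
  qed
  define \<kappa> where "\<kappa> = (LINT u|lborel. f1 u)"
  have e1: "(\<integral>\<^sup>+u. ennreal (f1 u) \<partial>lborel) = ennreal \<kappa>"
    unfolding \<kappa>_def using i1 nn by (intro nn_integral_eq_integral) auto
  have e2: "(\<integral>\<^sup>+u. ennreal (f2 u) \<partial>lborel) = ennreal (LINT u|lborel. f2 u)"
    using i2 nn by (intro nn_integral_eq_integral) auto
  have "\<kappa> = (2 * b + 3) * (LINT u|lborel. f2 u)"
    using parts i1 i2 by (simp add: \<kappa>_def)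
  then have "ennreal (2 * b + 3) * (\<integral>\<^sup>+u. ennreal (f2 u) \<partial>lborel) = ennreal \<kappa>"
    using b nn by (simp add: e2 ennreal_mult' integral_nonneg)
  moreover have "0 < \<kappa>"
  proof -
    \<comment> \<open>Positivity comes from the middle half of the interval, where
      \<open>1 - u^2 \<ge> 3/4\<close>. The exponent \<open>b + 1\<close> is positive, so the power
      is monotone even if \<open>b\<close> is negative.\<close>
    have "ennreal ((3/4) powr (b + 1)) = (\<integral>\<^sup>+u. ennreal ((3/4) powr (b + 1)) * indicator {-1/2..1/2::real} u \<partial>lborel)"
      by (simp add: nn_integral_cmult_indicator)
    also have "\<dots> \<le> (\<integral>\<^sup>+u. ennreal (f1 u) \<partial>lborel)"
    proof (intro nn_integral_mono)
      fix u :: real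
      show "ennreal ((3/4) powr (b + 1)) * indicator {-1/2..1/2} u \<le> ennreal (f1 u)"
      proof (cases "u \<in> {-1/2..1/2}")
        case True
        then have "\<bar>u\<bar>\<^sup>2 \<le> (1/2)\<^sup>2" by (intro power_mono) auto
        then have u: "3/4 \<le> 1 - u\<^sup>2" by (simp add: power2_eq_square)
        have "(3/4) powr (b + 1) \<le> (1 - u\<^sup>2) powr (b + 1)"
          using u b by (intro powr_mono2) auto
        also have "\<dots> \<le> (1 - u\<^sup>2) powr b" using u by (intro powr_mono') auto
        also have "\<dots> = f1 u" using True by (simp add: f1_def E_def)
        finally show ?thesis using True by (simp add: ennreal_leI)
      qed simp
    qed
    finally have "(3/4) powr (b + 1) \<le> \<kappa>"
      using e1 nn by (simp add: \<kappa>_def integral_nonneg)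
    moreover have "0 < (3/4::real) powr (b + 1)" by simp
    ultimately show ?thesis by linarith
  qed
  moreover have "(if u\<^sup>2 < 1 then ennreal ((1 - u\<^sup>2) powr b) else 0) = ennreal (f1 u)" for u
    by (simp add: sq f1_def)
  moreover have "ennreal (u\<^sup>2) * ennreal (f1 u) = ennreal (f2 u)" for u
    using nn by (simp add: f2_def ennreal_mult)
  ultimately show ?thesis using e1 by auto
qed

section \<open>The weight on Euclidean balls, its mass and its second moment\<close>

definition ssq :: "nat set \<Rightarrow> (nat \<Rightarrow> real) \<Rightarrow> real" where
  "ssq I x = (\<Sum>i\<in>I. (x i)\<^sup>2)"

text \<open>The second argument is the squared radius, so that a section of the weight at \<open>x p = y\<close> is the
  weight with \<open>s - y\<^sup>2\<close> in place of \<open>s\<close>, whatever the sign of \<open>s - y\<^sup>2\<close>.\<close>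

definition ball_weight :: "nat set \<Rightarrow> real \<Rightarrow> (nat \<Rightarrow> real) \<Rightarrow> ennreal" where
  "ball_weight I s x = (if ssq I x < s then ennreal (1 / sqrt (s - ssq I x)) else 0)"

abbreviation lebP :: "nat set \<Rightarrow> (nat \<Rightarrow> real) measure" where
  "lebP I \<equiv> Pi\<^sub>M I (\<lambda>_. lborel)"

text \<open>This is the total mass of \<open>ball_weight\<close>; the recursion over slices makes it
  a function of dimension and squared radius alone, whatever the index set.\<close>

primrec ball_mass :: "nat \<Rightarrow> real \<Rightarrow> ennreal" where
  "ball_mass 0 s = (if 0 < s then ennreal (1 / sqrt s) else 0)"
| "ball_mass (Suc m) s = (\<integral>\<^sup>+y. ball_mass m (s - y\<^sup>2) \<partial>lborel)"

text \<open>The second moment of one coordinate in dimension \<open>m + 1\<close>: the index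
  \<open>m\<close> counts only the remaining coordinates.\<close>

definition ball_moment :: "nat \<Rightarrow> real \<Rightarrow> ennreal" where
  "ball_moment m s = (\<integral>\<^sup>+y. ennreal (y\<^sup>2) * ball_mass m (s - y\<^sup>2) \<partial>lborel)"

interpretation lebP: product_sigma_finite "\<lambda>_::nat. lborel :: real measure"
  by standard

lemma ssq_measurable [measurable]: "ssq I \<in> borel_measurable (lebP I)"
  unfolding ssq_def by measurable

lemma ball_weight_measurable [measurable]: "ball_weight I s \<in> borel_measurable (lebP I)"
  unfolding ball_weight_def by measurable

lemma ssq_insert_upd: "finite I \<Longrightarrow> p \<notin> I \<Longrightarrow> ssq (insert p I) (x(p := y)) = y\<^sup>2 + ssq I x"
  unfolding ssq_def by (subst sum.insert) (auto intro!: sum.cong)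

lemma ball_weight_insert_upd: "finite I \<Longrightarrow> p \<notin> I \<Longrightarrow> ball_weight (insert p I) s (x(p := y)) = ball_weight I (s - y\<^sup>2) x"
  by (simp add: ball_weight_def ssq_insert_upd algebra_simps)

lemma ball_mass_measurable [measurable]: "ball_mass m \<in> borel_measurable borel"
proof (induction m)
  case 0
  show ?case unfolding ball_mass.simps by measurable
next
  case (Suc m)
  note Suc[measurable]
  show ?case unfolding ball_mass.simps by measurable
qed

lemma ball_weight_total:
  assumes "finite I"
  shows "(\<integral>\<^sup>+x. ball_weight I s x \<partial>lebP I) = ball_mass (card I) s"
  using assms
proof (induction I arbitrary: s rule: finite_induct)
  case empty
  show ?case by (subst lebP.nn_integral_empty) (auto simp: ball_weight_def ssq_def)
next
  case (insert p I)
  then show ?case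
    by (subst lebP.product_nn_integral_insert_rev) (auto simp: ball_weight_insert_upd)
qed

lemma ball_weight_second_moment:
  assumes "finite I" "i \<in> I"
  shows "(\<integral>\<^sup>+x. ennreal ((x i)\<^sup>2) * ball_weight I s x \<partial>lebP I) = ball_moment (card I - 1) s"
proof -
  obtain J where J: "I = insert i J" "i \<notin> J" "finite J" using assms by (metis finite_insert mk_disjoint_insert)
  have "(\<integral>\<^sup>+x. ennreal ((x i)\<^sup>2) * ball_weight I s x \<partial>lebP I)
      = (\<integral>\<^sup>+y. \<integral>\<^sup>+x. ennreal (y\<^sup>2) * ball_weight J (s - y\<^sup>2) x \<partial>lebP J \<partial>lborel)"
    unfolding J(1) using J(2,3)
    by (subst lebP.product_nn_integral_insert_rev) (auto simp: ball_weight_insert_upd)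
  also have "\<dots> = ball_moment (card J) s"
    unfolding ball_moment_def using J(3) by (auto simp: nn_integral_cmult ball_weight_total)
  finally show ?thesis using J by simp
qed

text \<open>The second moment of a coordinate \<open>i\<close> in dimension
  \<open>card J + 1\<close> is computed twice: the left side slices along \<open>i\<close> itself,
  the right side along another coordinate \<open>p\<close>, which leaves the moment of
  \<open>i\<close> in a ball of one dimension less.\<close>

lemma ball_moment_slice:
  fixes J :: "nat set"
  assumes "finite J" "p \<notin> J" "J \<noteq> {}"
  shows "ball_moment (card J) s = (\<integral>\<^sup>+y. ball_moment (card J - 1) (s - y\<^sup>2) \<partial>lborel)"
proof -
  obtain i where i: "i \<in> J" using assms by blast
  then have "p \<noteq> i" using assms by auto
  have "ball_moment (card J) s = (\<integral>\<^sup>+x. ennreal ((x i)\<^sup>2) * ball_weight (insert p J) s x \<partial>lebP (insert p J))"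
    using ball_weight_second_moment[of "insert p J" i s] assms i by simp
  also have "\<dots> = (\<integral>\<^sup>+y. \<integral>\<^sup>+x. ennreal ((x i)\<^sup>2) * ball_weight J (s - y\<^sup>2) x \<partial>lebP J \<partial>lborel)"
    using assms i \<open>p \<noteq> i\<close>
    by (subst lebP.product_nn_integral_insert_rev) (auto simp: ball_weight_insert_upd)
  finally show ?thesis using ball_weight_second_moment[of J i] assms i by simp
qed

text \<open>The substitution \<open>y = sqrt s * u\<close> in a slice pulls out a factor
  \<open>sqrt s\<close>, so each dimension raises the exponent by 1/2, starting from -1/2 in
  dimension 0. What is left is a beta integral.\<close>

lemma ball_mass_closed_form:
  "\<exists>z>0. \<forall>s. ball_mass m s = (if 0 < s then ennreal (z * s powr ((real m - 1) / 2)) else 0)"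
proof (induction m)
  case 0
  have "ball_mass 0 s = (if 0 < s then ennreal (1 * s powr ((real 0 - 1) / 2)) else 0)" for s
    by (simp add: powr_minus_divide powr_half_sqrt)
  then show ?case by (intro exI[of _ 1]) auto
next
  case (Suc m)
  define b where "b = (real m - 1) / 2"
  obtain z where z: "z > 0" "\<And>s. ball_mass m s = (if 0 < s then ennreal (z * s powr b) else 0)"
    using Suc unfolding b_def by blast
  obtain \<kappa> where \<kappa>: "\<kappa> > 0"
    "(\<integral>\<^sup>+u. (if u\<^sup>2 < 1 then ennreal ((1 - u\<^sup>2) powr b) else 0) \<partial>lborel) = ennreal \<kappa>"
    using beta_kernel_integral[of b] by (auto simp: b_def)
  have "ball_mass (Suc m) s = (if 0 < s then ennreal (z * \<kappa> * s powr ((real (Suc m) - 1) / 2)) else 0)" for s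
  proof (cases "0 < s")
    case False
    then have "\<not> 0 < s - y\<^sup>2" for y using zero_le_power2[of y] by linarith
    then show ?thesis using False by (simp add: z del: zero_less_diff diff_gt_0_iff_gt)
  next
    case True
    have "ball_mass (Suc m) s = ennreal \<bar>sqrt s\<bar> * (\<integral>\<^sup>+u. ball_mass m (s - (0 + sqrt s * u)\<^sup>2) \<partial>lborel)"
      unfolding ball_mass.simps using True by (intro nn_integral_real_affine) auto
    also have "(\<integral>\<^sup>+u. ball_mass m (s - (0 + sqrt s * u)\<^sup>2) \<partial>lborel)
        = (\<integral>\<^sup>+u. ennreal (z * s powr b) * (if u\<^sup>2 < 1 then ennreal ((1 - u\<^sup>2) powr b) else 0) \<partial>lborel)"
    proof (intro nn_integral_cong)
      fix u :: real
      have eq: "s - (0 + sqrt s * u)\<^sup>2 = s * (1 - u\<^sup>2)"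
        using True by (simp add: power_mult_distrib algebra_simps)
      show "ball_mass m (s - (0 + sqrt s * u)\<^sup>2)
          = ennreal (z * s powr b) * (if u\<^sup>2 < 1 then ennreal ((1 - u\<^sup>2) powr b) else 0)"
        unfolding eq z(2) using True z(1)
        by (auto simp: zero_less_mult_iff powr_mult ennreal_mult[symmetric] mult.assoc)
    qed
    also have "\<dots> = ennreal (z * s powr b) * ennreal \<kappa>"
      by (subst nn_integral_cmult) (auto simp: \<kappa>)
    also have "ennreal \<bar>sqrt s\<bar> * (ennreal (z * s powr b) * ennreal \<kappa>) = ennreal (z * \<kappa> * (s powr b * s powr (1/2)))"
      using True z(1) \<kappa>(1) by (simp add: ennreal_mult[symmetric] powr_half_sqrt algebra_simps)
    also have "s powr b * s powr (1/2) = s powr ((real (Suc m) - 1) / 2)"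
      by (simp add: powr_add[symmetric] b_def field_simps)
    finally show ?thesis using True by simp
  qed
  then show ?case using z(1) \<kappa>(1) by (intro exI[of _ "z * \<kappa>"]) auto
qed

lemma ball_mass_pos_finite: "0 < ball_mass m 1" "ball_mass m 1 < \<top>"
  using ball_mass_closed_form[of m] by auto

text \<open>After normalization, a single coordinate in dimension \<open>m + 1\<close> has mean
  square \<open>1 / (m + 2)\<close>. The slices carry the exponent \<open>b = (m - 1) / 2\<close>,
  and \<open>2 b + 3 = m + 2\<close>.\<close>

lemma ball_moment_mass: "ennreal (real m + 2) * ball_moment m 1 = ball_mass (Suc m) 1"
proof -
  define b where "b = (real m - 1) / 2"
  obtain z where z: "z > 0" "\<And>s. ball_mass m s = (if 0 < s then ennreal (z * s powr b) else 0)"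
    using ball_mass_closed_form[of m] unfolding b_def by blast
  define G where "G u = (if u\<^sup>2 < 1 then ennreal ((1 - u\<^sup>2) powr b) else 0)" for u :: real
  have [measurable]: "G \<in> borel_measurable borel" unfolding G_def by measurable
  have zG: "ball_mass m (1 - u\<^sup>2) = ennreal z * G u" for u
    using z by (auto simp: G_def ennreal_mult)
  obtain \<kappa> where \<kappa>: "(\<integral>\<^sup>+u. G u \<partial>lborel) = ennreal \<kappa>"
    "ennreal (2 * b + 3) * (\<integral>\<^sup>+u. ennreal (u\<^sup>2) * G u \<partial>lborel) = ennreal \<kappa>"
    using beta_kernel_integral[of b] unfolding G_def by (auto simp: b_def)
  have b: "2 * b + 3 = real m + 2" by (simp add: b_def field_simps)
  have "ball_moment m 1 = ennreal z * (\<integral>\<^sup>+u. ennreal (u\<^sup>2) * G u \<partial>lborel)"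
    unfolding ball_moment_def zG by (subst nn_integral_cmult[symmetric]) (auto simp: mult_ac)
  moreover have "ball_mass (Suc m) 1 = ennreal z * ennreal \<kappa>"
    unfolding ball_mass.simps zG \<kappa>(1)[symmetric] by (rule nn_integral_cmult) auto
  ultimately show ?thesis using \<kappa>(2)[unfolded b] by (simp only: mult.left_commute)
qed

section \<open>Rotations\<close>

lemma ball_moment_measurable [measurable]: "ball_moment m \<in> borel_measurable borel"
  unfolding ball_moment_def by measurable

text \<open>Affine rather than linear, because restricting a functional to a slice
  \<open>x p = y\<close> leaves a constant term.\<close>

definition affine_on :: "nat set \<Rightarrow> ((nat \<Rightarrow> real) \<Rightarrow> real) \<Rightarrow> bool" where
  "affine_on I f \<longleftrightarrow> (\<exists>c l. \<forall>x. f x = c + (\<Sum>i\<in>I. l i * x i))"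

text \<open>Rotations are described by the properties that the averaging argument uses and not by
  matrices. The clause with \<open>a\<close> and \<open>b\<close> lets the output of an algorithm be
  pulled back; like the clauses on \<open>ssq\<close>, it looks at the coordinates in
  \<open>I\<close> only.\<close>

definition rotation_on :: "nat set \<Rightarrow> ((nat \<Rightarrow> real) \<Rightarrow> nat \<Rightarrow> real) \<Rightarrow> bool" where
  "rotation_on I U \<longleftrightarrow> U \<in> measurable (lebP I) (lebP I) \<and> distr (lebP I) (lebP I) U = lebP I
     \<and> (\<forall>x. ssq I (U x) = ssq I x)
     \<and> (\<forall>x z. ssq I (\<lambda>i. U x i - U z i) = ssq I (\<lambda>i. x i - z i))
     \<and> (\<forall>a. \<exists>b. \<forall>i\<in>I. U b i = a i)
     \<and> (\<forall>f. affine_on I f \<longrightarrow> affine_on I (\<lambda>x. f (U x)))"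

lemma ssq_eq_0: "finite I \<Longrightarrow> ssq I x = 0 \<longleftrightarrow> (\<forall>i\<in>I. x i = 0)"
  by (simp add: ssq_def sum_nonneg_eq_0_iff)

lemma rotation_on_id: "rotation_on I (\<lambda>x. x)"
  by (auto simp: rotation_on_def distr_id)

lemma rotation_on_comp:
  assumes I: "finite I" and U: "rotation_on I U" and V: "rotation_on I V"
  shows "rotation_on I (\<lambda>x. U (V x))"
proof -
  have [measurable]: "U \<in> measurable (lebP I) (lebP I)" "V \<in> measurable (lebP I) (lebP I)"
    using U V by (auto simp: rotation_on_def)
  have "distr (lebP I) (lebP I) (\<lambda>x. U (V x)) = distr (distr (lebP I) (lebP I) V) (lebP I) U"
    by (subst distr_distr) (auto simp: comp_def)
  then have "distr (lebP I) (lebP I) (\<lambda>x. U (V x)) = lebP I"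
    using U V by (simp add: rotation_on_def)
  moreover have "\<exists>b. \<forall>i\<in>I. U (V b) i = a i" for a
  proof -
    obtain b1 where b1: "\<forall>i\<in>I. U b1 i = a i" using U unfolding rotation_on_def by blast
    obtain b2 where b2: "\<forall>i\<in>I. V b2 i = b1 i" using V unfolding rotation_on_def by blast
    \<comment> \<open>\<open>V b2\<close> and \<open>b1\<close> agree on \<open>I\<close> only; the
      isometry property of \<open>U\<close> carries this over to their images.\<close>
    have "ssq I (\<lambda>i. U (V b2) i - U b1 i) = ssq I (\<lambda>i. V b2 i - b1 i)"
      using U by (auto simp: rotation_on_def)
    also have "\<dots> = 0" using b2 I by (simp add: ssq_eq_0)
    finally have "\<forall>i\<in>I. U (V b2) i = U b1 i" using I by (simp add: ssq_eq_0)
    then show ?thesis using b1 by auto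
  qed
  ultimately show ?thesis using U V by (auto simp: rotation_on_def)
qed

text \<open>Two one-dimensional substitutions with an exchange of integrals in between: for fixed
  \<open>y\<close>, \<open>u = c x - s y\<close> contributes the factor
  \<open>1 / \<bar>c\<bar>\<close>, and for fixed \<open>u\<close>, \<open>v = (s u + y) / c\<close>
  cancels it. Both divide by \<open>c\<close>.\<close>

lemma nn_integral_rotate_plane:
  fixes h :: "real \<times> real \<Rightarrow> ennreal"
  assumes [measurable]: "h \<in> borel_measurable (lborel \<Otimes>\<^sub>M lborel)" and c: "c \<noteq> 0" and cs: "c\<^sup>2 + s\<^sup>2 = 1"
  shows "(\<integral>\<^sup>+x. \<integral>\<^sup>+y. h (c * x - s * y, s * x + c * y) \<partial>lborel \<partial>lborel) = (\<integral>\<^sup>+x. \<integral>\<^sup>+y. h (x, y) \<partial>lborel \<partial>lborel)"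
proof -
  have "(\<integral>\<^sup>+x. \<integral>\<^sup>+y. h (c * x - s * y, s * x + c * y) \<partial>lborel \<partial>lborel)
      = (\<integral>\<^sup>+y. \<integral>\<^sup>+x. h (c * x - s * y, s * x + c * y) \<partial>lborel \<partial>lborel)"
    by (rule lborel_pair.Fubini'[symmetric]) measurable
  also have "\<dots> = (\<integral>\<^sup>+y. \<integral>\<^sup>+u. ennreal \<bar>1 / c\<bar> * h (u, s * u / c + (1 / c) * y) \<partial>lborel \<partial>lborel)"
  proof (rule nn_integral_cong)
    fix y :: real
    have "(\<integral>\<^sup>+x. h (c * x - s * y, s * x + c * y) \<partial>lborel)
        = ennreal \<bar>1 / c\<bar> * (\<integral>\<^sup>+u. h (c * (s * y / c + (1 / c) * u) - s * y, s * (s * y / c + (1 / c) * u) + c * y) \<partial>lborel)"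
      using c by (intro nn_integral_real_affine) auto
    also have "\<dots> = (\<integral>\<^sup>+u. ennreal \<bar>1 / c\<bar> * h (c * (s * y / c + (1 / c) * u) - s * y, s * (s * y / c + (1 / c) * u) + c * y) \<partial>lborel)"
      by (rule nn_integral_cmult[symmetric]) measurable
    also have "\<dots> = (\<integral>\<^sup>+u. ennreal \<bar>1 / c\<bar> * h (u, s * u / c + (1 / c) * y) \<partial>lborel)"
    proof (rule nn_integral_cong)
      fix u :: real
      have 1: "c * (s * y / c + (1 / c) * u) - s * y = u" using c by (simp add: field_simps)
      have "s * (s * y / c + (1 / c) * u) + c * y = (s * u + (c\<^sup>2 + s\<^sup>2) * y) / c"
        using c by (simp add: field_simps power2_eq_square)
      then have 2: "s * (s * y / c + (1 / c) * u) + c * y = s * u / c + (1 / c) * y"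
        using cs by (simp add: add_divide_distrib)
      show "ennreal \<bar>1 / c\<bar> * h (c * (s * y / c + (1 / c) * u) - s * y, s * (s * y / c + (1 / c) * u) + c * y)
        = ennreal \<bar>1 / c\<bar> * h (u, s * u / c + (1 / c) * y)"
        unfolding 1 2 ..
    qed
    finally show "(\<integral>\<^sup>+x. h (c * x - s * y, s * x + c * y) \<partial>lborel)
        = (\<integral>\<^sup>+u. ennreal \<bar>1 / c\<bar> * h (u, s * u / c + (1 / c) * y) \<partial>lborel)" .
  qed
  also have "\<dots> = (\<integral>\<^sup>+u. \<integral>\<^sup>+y. ennreal \<bar>1 / c\<bar> * h (u, s * u / c + (1 / c) * y) \<partial>lborel \<partial>lborel)"
    by (rule lborel_pair.Fubini') measurable
  also have "\<dots> = (\<integral>\<^sup>+u. \<integral>\<^sup>+v. h (u, v) \<partial>lborel \<partial>lborel)"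
  proof (rule nn_integral_cong)
    fix u :: real
    have "(\<integral>\<^sup>+v. h (u, v) \<partial>lborel) = ennreal \<bar>1 / c\<bar> * (\<integral>\<^sup>+y. h (u, s * u / c + (1 / c) * y) \<partial>lborel)"
      using c by (intro nn_integral_real_affine) auto
    also have "\<dots> = (\<integral>\<^sup>+y. ennreal \<bar>1 / c\<bar> * h (u, s * u / c + (1 / c) * y) \<partial>lborel)"
      by (rule nn_integral_cmult[symmetric]) measurable
    finally show "(\<integral>\<^sup>+y. ennreal \<bar>1 / c\<bar> * h (u, s * u / c + (1 / c) * y) \<partial>lborel) = (\<integral>\<^sup>+v. h (u, v) \<partial>lborel)" ..
  qed
  finally show ?thesis .
qed

section \<open>Plane rotations and the reduction of an affine functional to one coordinate\<close>

definition givens :: "real \<Rightarrow> real \<Rightarrow> nat \<Rightarrow> nat \<Rightarrow> (nat \<Rightarrow> real) \<Rightarrow> nat \<Rightarrow> real" where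
  "givens c s p j x = x(p := c * x p - s * x j, j := s * x p + c * x j)"

lemma givens_measurable:
  assumes "p \<in> I" "j \<in> I"
  shows "givens c s p j \<in> measurable (lebP I) (lebP I)"
proof -
  show ?thesis
    unfolding givens_def using assms
    by (intro measurable_fun_upd[where J = I]) (auto intro!: borel_measurable_add borel_measurable_diff borel_measurable_times measurable_component_singleton simp: insert_absorb)
qed

lemma nn_integral_givens:
  assumes I: "finite I" "p \<in> I" "j \<in> I" "p \<noteq> j" and c: "c \<noteq> 0" "c\<^sup>2 + s\<^sup>2 = 1"
    and [measurable]: "g \<in> borel_measurable (lebP I)"
  shows "(\<integral>\<^sup>+x. g (givens c s p j x) \<partial>lebP I) = (\<integral>\<^sup>+x. g x \<partial>lebP I)"
proof -
  define J where "J = I - {p, j}"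
  have J: "finite J" "j \<notin> J" "p \<notin> insert j J" and IJ: "I = insert p (insert j J)"
    using I by (auto simp: J_def)
  interpret SJ: sigma_finite_measure "lebP J" using J(1) by (rule lebP.sigma_finite)
  have unfold: "(\<integral>\<^sup>+x. G x \<partial>lebP I) = (\<integral>\<^sup>+y. \<integral>\<^sup>+z. \<integral>\<^sup>+x. G (x(j := z, p := y)) \<partial>lebP J \<partial>lborel \<partial>lborel)"
    if G: "G \<in> borel_measurable (lebP I)" for G
  proof -
    have G'[measurable]: "G \<in> borel_measurable (lebP (insert p (insert j J)))" using G by (simp add: IJ)
    have m: "(\<lambda>x. G (x(p := y))) \<in> borel_measurable (lebP (insert j J))" for y
      by (rule measurable_compose[OF _ G'], rule measurable_fun_upd[where J = "insert j J"]) auto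
    show ?thesis
      unfolding IJ using J
      by (subst lebP.product_nn_integral_insert_rev[OF _ _ G'])
         (auto intro!: nn_integral_cong simp: lebP.product_nn_integral_insert_rev m)
  qed
  \<comment> \<open>\<open>H\<close> integrates out the coordinates that the rotation leaves fixed,
    which reduces the claim to the plane.\<close>
  define H where "H yz = (\<integral>\<^sup>+x. g (x(j := snd yz, p := fst yz)) \<partial>lebP J)" for yz
  have [measurable]: "H \<in> borel_measurable (lborel \<Otimes>\<^sub>M lborel)"
  proof -
    have "(\<lambda>(yz, x). g (x(j := snd yz, p := fst yz))) \<in> borel_measurable ((lborel \<Otimes>\<^sub>M lborel) \<Otimes>\<^sub>M lebP J)"
      unfolding split_beta
      by (rule measurable_compose[where N = "lebP I" and g = g], rule measurable_fun_upd[where J = "insert j J"],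
          (auto simp: IJ)[1], rule measurable_fun_upd[where J = J]) auto
    then show ?thesis unfolding H_def by (intro SJ.borel_measurable_nn_integral) (simp add: split_beta)
  qed
  have "(\<integral>\<^sup>+x. g (givens c s p j x) \<partial>lebP I)
      = (\<integral>\<^sup>+y. \<integral>\<^sup>+z. H (c * y - s * z, s * y + c * z) \<partial>lborel \<partial>lborel)"
  proof (subst unfold)
    show "(\<lambda>x. g (givens c s p j x)) \<in> borel_measurable (lebP I)"
      by (rule measurable_compose[OF givens_measurable[OF I(2,3)]]) auto
    have "givens c s p j (x(j := z, p := y)) = x(j := s * y + c * z, p := c * y - s * z)" for x y z
      using I(4) by (auto simp: givens_def fun_eq_iff)
    then show "(\<integral>\<^sup>+y. \<integral>\<^sup>+z. \<integral>\<^sup>+x. g (givens c s p j (x(j := z, p := y))) \<partial>lebP J \<partial>lborel \<partial>lborel)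
      = (\<integral>\<^sup>+y. \<integral>\<^sup>+z. H (c * y - s * z, s * y + c * z) \<partial>lborel \<partial>lborel)"
      by (simp add: H_def)
  qed
  also have "\<dots> = (\<integral>\<^sup>+y. \<integral>\<^sup>+z. H (y, z) \<partial>lborel \<partial>lborel)"
    using c by (intro nn_integral_rotate_plane) auto
  also have "\<dots> = (\<integral>\<^sup>+x. g x \<partial>lebP I)"
    by (subst unfold) (auto simp: H_def)
  finally show ?thesis .
qed

lemma sum_split_pair:
  fixes f :: "'a \<Rightarrow> real"
  assumes "finite I" "p \<in> I" "j \<in> I" "p \<noteq> j"
  shows "(\<Sum>i\<in>I. f i) = f p + f j + (\<Sum>i\<in>I - {p, j}. f i)"
proof -
  have "I = insert p (insert j (I - {p, j}))" using assms by auto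
  then have "(\<Sum>i\<in>I. f i) = (\<Sum>i\<in>insert p (insert j (I - {p, j})). f i)" by simp
  also have "\<dots> = f p + f j + (\<Sum>i\<in>I - {p, j}. f i)"
    using assms by (subst sum.insert) auto
  finally show ?thesis .
qed

lemma sum_givens:
  assumes "finite I" "p \<in> I" "j \<in> I" "p \<noteq> j"
  shows "(\<Sum>i\<in>I. l i * givens c s p j x i)
    = (\<Sum>i\<in>I. (l(p := c * l p + s * l j, j := c * l j - s * l p)) i * x i)"
  unfolding sum_split_pair[OF assms] using assms
  by (auto simp: givens_def algebra_simps intro!: sum.cong)

lemma ssq_givens:
  assumes "finite I" "p \<in> I" "j \<in> I" "p \<noteq> j" "c\<^sup>2 + s\<^sup>2 = 1"
  shows "ssq I (givens c s p j x) = ssq I x"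
proof -
  have "(c * x p - s * x j)\<^sup>2 + (s * x p + c * x j)\<^sup>2 = (c\<^sup>2 + s\<^sup>2) * ((x p)\<^sup>2 + (x j)\<^sup>2)"
    by (simp add: algebra_simps power2_eq_square)
  then show ?thesis
    unfolding ssq_def sum_split_pair[OF assms(1-4)] using assms
    by (auto simp: givens_def intro!: sum.cong)
qed

lemma rotation_on_givens:
  assumes I: "finite I" "p \<in> I" "j \<in> I" "p \<noteq> j" and c: "c \<noteq> 0" "c\<^sup>2 + s\<^sup>2 = 1"
  shows "rotation_on I (givens c s p j)"
  unfolding rotation_on_def
proof (intro conjI allI impI)
  show m[measurable]: "givens c s p j \<in> measurable (lebP I) (lebP I)"
    by (rule givens_measurable[OF I(2,3)])
  show "distr (lebP I) (lebP I) (givens c s p j) = lebP I"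
  proof (rule measure_eqI)
    fix A assume "A \<in> sets (distr (lebP I) (lebP I) (givens c s p j))"
    then have A[measurable]: "A \<in> sets (lebP I)" by simp
    have "emeasure (distr (lebP I) (lebP I) (givens c s p j)) A
        = (\<integral>\<^sup>+x. indicator A x \<partial>distr (lebP I) (lebP I) (givens c s p j))" by simp
    also have "\<dots> = (\<integral>\<^sup>+x. indicator A (givens c s p j x) \<partial>lebP I)"
      by (rule nn_integral_distr) auto
    also have "\<dots> = emeasure (lebP I) A"
      using nn_integral_givens[OF I c, of "indicator A"] by simp
    finally show "emeasure (distr (lebP I) (lebP I) (givens c s p j)) A = emeasure (lebP I) A" .
  qed simp
  show "ssq I (givens c s p j x) = ssq I x" for x
    using ssq_givens[OF I c(2)] .
  show "ssq I (\<lambda>i. givens c s p j x i - givens c s p j z i) = ssq I (\<lambda>i. x i - z i)" for x z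
  proof -
    have "(\<lambda>i. givens c s p j x i - givens c s p j z i) = givens c s p j (\<lambda>i. x i - z i)"
      using I(4) by (auto simp: givens_def fun_eq_iff algebra_simps)
    then show ?thesis using ssq_givens[OF I c(2)] by simp
  qed
  show "\<exists>b. \<forall>i\<in>I. givens c s p j b i = a i" for a
  proof -
    have "c * (c * a p + s * a j) - s * (c * a j - s * a p) = (c\<^sup>2 + s\<^sup>2) * a p"
         "s * (c * a p + s * a j) + c * (c * a j - s * a p) = (c\<^sup>2 + s\<^sup>2) * a j"
      by (simp_all add: algebra_simps power2_eq_square)
    then have "givens c s p j (a(p := c * a p + s * a j, j := c * a j - s * a p)) = a"
      using I(4) c by (auto simp: givens_def fun_eq_iff)
    then show ?thesis by metis
  qed
  show "affine_on I (\<lambda>x. f (givens c s p j x))" if f: "affine_on I f" for f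
  proof -
    obtain k l where "\<And>x. f x = k + (\<Sum>i\<in>I. l i * x i)" using f by (auto simp: affine_on_def)
    then have "f (givens c s p j x)
        = k + (\<Sum>i\<in>I. (l(p := c * l p + s * l j, j := c * l j - s * l p)) i * x i)" for x
      by (simp only: sum_givens[OF I])
    then show ?thesis unfolding affine_on_def by blast
  qed
qed

text \<open>Starting from a coordinate \<open>p\<close> with nonzero coefficient, plane rotations
  clear the other coefficients one at a time. The coefficient at \<open>p\<close> stays nonzero, and
  so does the cosine of the next rotation, as \<open>rotation_on_givens\<close> requires.\<close>

lemma rotate_affine_to_coordinate:
  assumes I: "finite I" "I \<noteq> {}" and f: "affine_on I f"
  shows "\<exists>U p c \<rho>. p \<in> I \<and> rotation_on I U \<and> (\<forall>x. f (U x) = c + \<rho> * x p)"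
proof -
  obtain c l where l: "\<And>x. f x = c + (\<Sum>i\<in>I. l i * x i)" using f by (auto simp: affine_on_def)
  show ?thesis
  proof (cases "\<forall>i\<in>I. l i = 0")
    case True
    obtain p where "p \<in> I" using I by blast
    then show ?thesis using True l rotation_on_id
      by (intro exI[of _ "\<lambda>x. x"] exI[of _ p] exI[of _ c] exI[of _ 0]) simp
  next
    case False
    then obtain p where p: "p \<in> I" "l p \<noteq> 0" by blast
    have "\<exists>U l'. rotation_on I U \<and> l' p \<noteq> 0 \<and> (\<forall>j\<in>J. l' j = 0) \<and> (\<forall>x. f (U x) = c + (\<Sum>i\<in>I. l' i * x i))"
      if "finite J" "J \<subseteq> I - {p}" for J
      using that
    proof (induction J rule: finite_induct)
      case empty
      then show ?case using p l rotation_on_id by (intro exI[of _ "\<lambda>x. x"] exI[of _ l]) auto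
    next
      case (insert j J)
      then obtain U l' where U: "rotation_on I U" and l': "l' p \<noteq> 0" "\<forall>j\<in>J. l' j = 0"
        "\<And>x. f (U x) = c + (\<Sum>i\<in>I. l' i * x i)" by auto
      have j: "j \<in> I" "p \<noteq> j" using insert.prems by auto
      define \<rho> where "\<rho> = sqrt ((l' p)\<^sup>2 + (l' j)\<^sup>2)"
      have pos: "0 < (l' p)\<^sup>2 + (l' j)\<^sup>2" using l'(1) by (simp add: sum_power2_gt_zero_iff)
      have \<rho>: "\<rho> > 0" "\<rho>\<^sup>2 = (l' p)\<^sup>2 + (l' j)\<^sup>2"
        using pos by (auto simp: \<rho>_def)
      \<comment> \<open>Cosine and sine of the angle that turns \<open>(l' p, l' j)\<close> onto the
        axis of \<open>p\<close>; the new coefficients are \<open>\<rho>\<close> and 0.\<close>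
      define a b where "a = l' p / \<rho>" and "b = l' j / \<rho>"
      have "a\<^sup>2 + b\<^sup>2 = ((l' p)\<^sup>2 + (l' j)\<^sup>2) / \<rho>\<^sup>2"
        by (simp add: a_def b_def power_divide add_divide_distrib)
      then have ab: "a \<noteq> 0" "a\<^sup>2 + b\<^sup>2 = 1"
        using \<rho> l'(1) pos by (simp_all add: a_def)
      define l'' where "l'' = l'(p := a * l' p + b * l' j, j := a * l' j - b * l' p)"
      have "rotation_on I (\<lambda>x. U (givens a b p j x))"
        by (rule rotation_on_comp[OF I(1) U rotation_on_givens[OF I(1) p(1) j ab]])
      moreover have "a * l' p + b * l' j = ((l' p)\<^sup>2 + (l' j)\<^sup>2) / \<rho>"
        by (simp add: a_def b_def power2_eq_square add_divide_distrib)
      then have "l'' p \<noteq> 0" using \<rho> pos j by (auto simp: l''_def)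
      moreover have "\<forall>i\<in>insert j J. l'' i = 0"
        using l'(2) insert.prems insert.hyps by (auto simp: l''_def a_def b_def)
      moreover have "f (U (givens a b p j x)) = c + (\<Sum>i\<in>I. l'' i * x i)" for x
        unfolding l' l''_def by (subst sum_givens[OF I(1) p(1) j]) simp
      ultimately show ?case by blast
    qed
    from this[of "I - {p}"] I obtain U l' where U: "rotation_on I U" "\<forall>j\<in>I - {p}. l' j = 0"
      "\<And>x. f (U x) = c + (\<Sum>i\<in>I. l' i * x i)" by auto
    have "(\<Sum>i\<in>I. l' i * x i) = l' p * x p" for x
      using U(2) I p by (subst sum.remove[of _ p]) auto
    then show ?thesis using U p by auto
  qed
qed

lemma nn_integral_lebP_uminus:
  assumes "finite I" "g \<in> borel_measurable (lebP I)"
  shows "(\<integral>\<^sup>+x. g (\<lambda>i\<in>I. - x i) \<partial>lebP I) = (\<integral>\<^sup>+x. g x \<partial>lebP I)"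
  using assms
proof (induction I arbitrary: g rule: finite_induct)
  case empty
  then show ?case by (simp add: PiM_empty nn_integral_count_space_finite restrict_def)
next
  case (insert p I)
  note g[measurable] = insert.prems
  interpret SI: sigma_finite_measure "lebP I" using insert.hyps(1) by (rule lebP.sigma_finite)
  have neg: "(\<lambda>x. \<lambda>i\<in>K. - x i) \<in> measurable (lebP K) (lebP K)" for K
    by (intro measurable_restrict) measurable
  have upd: "(\<lambda>x. g (x(p := y))) \<in> borel_measurable (lebP I)" for y
    by (rule measurable_compose[OF _ g], rule measurable_fun_upd[where J = I]) auto
  have upd2: "(\<lambda>y. \<integral>\<^sup>+x. g (x(p := y)) \<partial>lebP I) \<in> borel_measurable borel"
  proof -
    have "(\<lambda>(y, x). g (x(p := y))) \<in> borel_measurable (borel \<Otimes>\<^sub>M lebP I)"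
      unfolding split_beta by (rule measurable_compose[OF _ g], rule measurable_fun_upd[where J = I]) auto
    then show ?thesis by (rule SI.borel_measurable_nn_integral)
  qed
  have eq: "(\<lambda>i\<in>insert p I. - (x(p := y)) i) = (\<lambda>i\<in>I. - x i)(p := - y)" for x y
    using insert.hyps by (auto simp: fun_eq_iff)
  have "(\<integral>\<^sup>+x. g (\<lambda>i\<in>insert p I. - x i) \<partial>lebP (insert p I))
      = (\<integral>\<^sup>+y. \<integral>\<^sup>+x. g (\<lambda>i\<in>insert p I. - (x(p := y)) i) \<partial>lebP I \<partial>lborel)"
    by (rule lebP.product_nn_integral_insert_rev[OF insert.hyps measurable_compose[OF neg g]])
  also have "\<dots> = (\<integral>\<^sup>+y. \<integral>\<^sup>+x. g ((\<lambda>i\<in>I. - x i)(p := - y)) \<partial>lebP I \<partial>lborel)"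
    unfolding eq ..
  also have "\<dots> = (\<integral>\<^sup>+y. \<integral>\<^sup>+x. g (x(p := - y)) \<partial>lebP I \<partial>lborel)"
    by (intro nn_integral_cong insert.IH upd)
  also have "\<dots> = (\<integral>\<^sup>+y. \<integral>\<^sup>+x. g (x(p := y)) \<partial>lebP I \<partial>lborel)"
    using nn_integral_real_affine[OF upd2, of "-1" 0] by simp
  also have "\<dots> = (\<integral>\<^sup>+x. g x \<partial>lebP (insert p I))"
    using insert.hyps by (subst lebP.product_nn_integral_insert_rev) auto
  finally show ?case .
qed

section \<open>Average error of adaptive algorithms\<close>

lemma info_comp: "info L n (h x) = info (\<lambda>k ys z. L k ys (h z)) n x"
  by (induction n) (simp_all add: Let_def)

text \<open>\<open>info\<close> appends measurements at the end, whereas the induction on adaptive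
  algorithms removes the first one: its value becomes a fixed prefix for the later choices.\<close>

lemma info_Cons: "info L (Suc n) x = L 0 [] x # info (\<lambda>k ys. L (Suc k) (L 0 [] x # ys)) n x"
proof (induction n)
  case (Suc n)
  have "info L (Suc (Suc n)) x = (let ys = info L (Suc n) x in ys @ [L (Suc n) ys x])"
    by (simp only: info.simps(2)[of L "Suc n"])
  then show ?case unfolding Suc by (simp add: Let_def)
qed simp

text \<open>The case without measurements, where the output is a constant \<open>a\<close>. By
  reflection symmetry of the weight, \<open>|x - a|\<close> may be replaced by the mean of
  \<open>|x - a|\<close> and \<open>|x + a|\<close>, which is at least \<open>|x|\<close>, and
  \<open>|x| \<ge> |x|^2\<close> in a ball of radius at most 1. The integral of the square splits
  into coordinates.\<close>

lemma centered_second_moment_lower: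
  assumes I: "finite I" and s: "s \<le> 1"
  shows "ennreal (real (card I)) * ball_moment (card I - 1) s
    \<le> (\<integral>\<^sup>+x. ennreal (sqrt (ssq I (\<lambda>i. x i - a i))) * ball_weight I s x \<partial>lebP I)"
proof -
  define N where "N x = sqrt (ssq I x)" for x
  have Nm: "(\<lambda>x. N (\<lambda>i. x i - b i)) \<in> borel_measurable (lebP I)" for b
    unfolding N_def ssq_def by measurable
  define f where "f b x = ennreal (N (\<lambda>i. x i - b i)) * ball_weight I s x" for b x
  have fm [measurable]: "f b \<in> borel_measurable (lebP I)" for b
    unfolding f_def using Nm[of b] by measurable
  have refl: "f a (\<lambda>i\<in>I. - x i) = f (\<lambda>i. - a i) x" for x
  proof -
    have "ssq I (\<lambda>i\<in>I. - x i) = ssq I x" by (simp add: ssq_def)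
    moreover have "(- x i - a i)\<^sup>2 = (x i + a i)\<^sup>2" for i by (simp add: power2_eq_square algebra_simps)
    then have "N (\<lambda>i. (\<lambda>i\<in>I. - x i) i - a i) = N (\<lambda>i. x i - - a i)"
      by (simp add: N_def ssq_def)
    ultimately show ?thesis unfolding f_def by (simp add: ball_weight_def)
  qed
  have tri: "2 * N x \<le> N (\<lambda>i. x i - a i) + N (\<lambda>i. x i - - a i)" for x
  proof -
    have "2 * N x = L2_set (\<lambda>i. (x i - a i) + (x i - - a i)) I"
      by (simp add: L2_set_def N_def ssq_def power_mult_distrib sum_distrib_left[symmetric] real_sqrt_mult)
    also have "\<dots> \<le> L2_set (\<lambda>i. x i - a i) I + L2_set (\<lambda>i. x i - - a i) I"
      by (rule L2_set_triangle_ineq)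
    finally show ?thesis by (simp add: L2_set_def N_def ssq_def)
  qed
  have N_nn: "0 \<le> N x" for x by (simp add: N_def ssq_def sum_nonneg)
  have ptw: "ennreal 2 * (ennreal (ssq I x) * ball_weight I s x) \<le> f a x + f (\<lambda>i. - a i) x" for x
  proof (cases "ssq I x < s")
    case True
    have nn: "0 \<le> ssq I x" by (simp add: ssq_def sum_nonneg)
    have "ssq I x * ssq I x \<le> 1 * ssq I x" using True s nn by (intro mult_right_mono) auto
    then have "ssq I x \<le> N x"
      unfolding N_def using nn by (intro real_le_rsqrt) (simp add: power2_eq_square)
    then have "2 * ssq I x \<le> N (\<lambda>i. x i - a i) + N (\<lambda>i. x i - - a i)" using tri[of x] by linarith
    then have "ennreal (2 * ssq I x) \<le> ennreal (N (\<lambda>i. x i - a i)) + ennreal (N (\<lambda>i. x i - - a i))"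
      unfolding ennreal_plus[OF N_nn N_nn, symmetric] by (rule ennreal_leI)
    then have "ennreal (2 * ssq I x) * ball_weight I s x
        \<le> (ennreal (N (\<lambda>i. x i - a i)) + ennreal (N (\<lambda>i. x i - - a i))) * ball_weight I s x"
      by (rule mult_right_mono) simp
    then show ?thesis unfolding f_def using nn
      by (simp add: ennreal_mult distrib_right mult.assoc)
  next
    case False
    then show ?thesis by (simp add: ball_weight_def)
  qed
  have "(\<integral>\<^sup>+x. ennreal (ssq I x) * ball_weight I s x \<partial>lebP I) = (\<integral>\<^sup>+x. (\<Sum>i\<in>I. ennreal ((x i)\<^sup>2) * ball_weight I s x) \<partial>lebP I)"
    by (simp add: ssq_def sum_distrib_right[symmetric])
  also have "\<dots> = (\<Sum>i\<in>I. \<integral>\<^sup>+x. ennreal ((x i)\<^sup>2) * ball_weight I s x \<partial>lebP I)"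
    by (rule nn_integral_sum) measurable
  also have "\<dots> = ennreal (real (card I)) * ball_moment (card I - 1) s"
    using ball_weight_second_moment[OF I] by (simp add: ennreal_of_nat_eq_real_of_nat)
  finally have "ennreal 2 * (ennreal (real (card I)) * ball_moment (card I - 1) s)
      = (\<integral>\<^sup>+x. ennreal 2 * (ennreal (ssq I x) * ball_weight I s x) \<partial>lebP I)"
    by (subst nn_integral_cmult) auto
  also have "\<dots> \<le> (\<integral>\<^sup>+x. f a x + f (\<lambda>i. - a i) x \<partial>lebP I)"
    by (intro nn_integral_mono ptw)
  also have "\<dots> = (\<integral>\<^sup>+x. f a x \<partial>lebP I) + (\<integral>\<^sup>+x. f (\<lambda>i. - a i) x \<partial>lebP I)"
    by (rule nn_integral_add) auto
  also have "(\<integral>\<^sup>+x. f (\<lambda>i. - a i) x \<partial>lebP I) = (\<integral>\<^sup>+x. f a x \<partial>lebP I)"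
    using nn_integral_lebP_uminus[OF I fm, of a] by (simp only: refl)
  also have "(\<integral>\<^sup>+x. f a x \<partial>lebP I) + (\<integral>\<^sup>+x. f a x \<partial>lebP I) = ennreal 2 * (\<integral>\<^sup>+x. f a x \<partial>lebP I)"
    by (simp add: mult_2)
  finally show ?thesis
    unfolding f_def N_def by (subst (asm) ennreal_mult_le_mult_iff) auto
qed

text \<open>The functionals may depend non-measurably on the observed values: Tonelli is applied only to
  the measurable majorant \<open>g\<close>, after rotating the first functional into a coordinate.\<close>

lemma adaptive_average_error_lower:
  assumes "finite I" "s \<le> 1" and "\<And>j ys. j < k \<Longrightarrow> affine_on I (L j ys)"
    and "g \<in> borel_measurable (lebP I)"
    and "\<And>x. x \<in> space (lebP I) \<Longrightarrow> ssq I x < s \<Longrightarrow>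
      ennreal (sqrt (ssq I (\<lambda>i. x i - \<phi> (info L k x) i))) \<le> g x"
  shows "ennreal (real (card I - k)) * ball_moment (card I - 1) s \<le> (\<integral>\<^sup>+x. g x * ball_weight I s x \<partial>lebP I)"
  using assms
proof (induction k arbitrary: I s L g \<phi>)
  case 0
  have "ennreal (real (card I)) * ball_moment (card I - 1) s
      \<le> (\<integral>\<^sup>+x. ennreal (sqrt (ssq I (\<lambda>i. x i - \<phi> [] i))) * ball_weight I s x \<partial>lebP I)"
    by (rule centered_second_moment_lower) fact+
  also have "\<dots> \<le> (\<integral>\<^sup>+x. g x * ball_weight I s x \<partial>lebP I)"
  proof (rule nn_integral_mono)
    fix x assume x: "x \<in> space (lebP I)"
    show "ennreal (sqrt (ssq I (\<lambda>i. x i - \<phi> [] i))) * ball_weight I s x \<le> g x * ball_weight I s x"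
      using "0.prems"(5)[OF x] by (cases "ssq I x < s") (auto intro: mult_right_mono simp: ball_weight_def)
  qed
  finally show ?case by simp
next
  case (Suc k)
  note I = Suc.prems(1) and s = Suc.prems(2) and aff = Suc.prems(3) and g = Suc.prems(4) and lower = Suc.prems(5)
  show ?case
  proof (cases "I = {}")
    case True
    then show ?thesis by simp
  next
    case False
    obtain U p c \<rho> where p: "p \<in> I" and U: "rotation_on I U" and Up: "\<And>x. L 0 [] (U x) = c + \<rho> * x p"
      using rotate_affine_to_coordinate[OF I False aff[of 0 "[]"]] by auto
    have Um [measurable]: "U \<in> measurable (lebP I) (lebP I)" and Ud: "distr (lebP I) (lebP I) U = lebP I"
      and Us: "\<And>x. ssq I (U x) = ssq I x"
      and Ui: "\<And>x z. ssq I (\<lambda>i. U x i - U z i) = ssq I (\<lambda>i. x i - z i)"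
      and Usurj: "\<And>a. \<exists>b. \<forall>i\<in>I. U b i = a i"
      and Uaff: "\<And>f. affine_on I f \<Longrightarrow> affine_on I (\<lambda>x. f (U x))"
      using U unfolding rotation_on_def by blast+
    define J where "J = I - {p}"
    have J: "finite J" "p \<notin> J" and IJ: "I = insert p J" using I p by (auto simp: J_def)
    have cJ: "card I = Suc (card J)" using J by (simp add: IJ)
    have gU: "(\<lambda>x. g (U x)) \<in> borel_measurable (lebP I)" by (rule measurable_compose[OF Um g])
    have gw: "(\<lambda>x. g x * ball_weight I s x) \<in> borel_measurable (lebP I)" using g by measurable
    have gUw: "(\<lambda>x. g (U x) * ball_weight I s x) \<in> borel_measurable (lebP I)" using gU by measurable
    have "(\<integral>\<^sup>+x. g x * ball_weight I s x \<partial>lebP I) = (\<integral>\<^sup>+x. g x * ball_weight I s x \<partial>distr (lebP I) (lebP I) U)"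
      by (simp only: Ud)
    also have "\<dots> = (\<integral>\<^sup>+x. g (U x) * ball_weight I s (U x) \<partial>lebP I)"
      by (rule nn_integral_distr) (use gw in auto)
    also have "\<dots> = (\<integral>\<^sup>+x. g (U x) * ball_weight I s x \<partial>lebP I)"
      unfolding ball_weight_def Us ..
    also have "\<dots> = (\<integral>\<^sup>+y. \<integral>\<^sup>+x. g (U (x(p := y))) * ball_weight I s (x(p := y)) \<partial>lebP J \<partial>lborel)"
      using gUw unfolding IJ by (rule lebP.product_nn_integral_insert_rev[OF J])
    also have "\<dots> = (\<integral>\<^sup>+y. \<integral>\<^sup>+x. g (U (x(p := y))) * ball_weight J (s - y\<^sup>2) x \<partial>lebP J \<partial>lborel)"
      unfolding IJ ball_weight_insert_upd[OF J] ..
    finally have eq: "(\<integral>\<^sup>+x. g x * ball_weight I s x \<partial>lebP I)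
      = (\<integral>\<^sup>+y. \<integral>\<^sup>+x. g (U (x(p := y))) * ball_weight J (s - y\<^sup>2) x \<partial>lebP J \<partial>lborel)" .
    have fibre: "ennreal (real (card J - k)) * ball_moment (card J - 1) (s - y\<^sup>2)
        \<le> (\<integral>\<^sup>+x. g (U (x(p := y))) * ball_weight J (s - y\<^sup>2) x \<partial>lebP J)" for y
    proof -
      define y1 where "y1 = c + \<rho> * y"
      \<comment> \<open>On the slice \<open>x p = y\<close> the first measured value is the constant
        \<open>y1\<close>. What remains is an algorithm with \<open>k\<close> measurements for the
        coordinates in \<open>J\<close> at squared radius \<open>s - y^2\<close>, to which the
        induction hypothesis applies.\<close>
      define L' where "L' j ys x = L (Suc j) (y1 # ys) (U (x(p := y)))" for j ys x
      \<comment> \<open>A preimage of the output under the rotation, so that the distance of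
        \<open>U x'\<close> to the output becomes the distance of \<open>x'\<close> to this
        preimage.\<close>
      define \<phi>' where "\<phi>' ys = (SOME b. \<forall>i\<in>I. U b i = \<phi> (y1 # ys) i)" for ys
      have \<phi>': "\<forall>i\<in>I. U (\<phi>' ys) i = \<phi> (y1 # ys) i" for ys
        unfolding \<phi>'_def by (rule someI_ex[OF Usurj])
      have inf: "info L (Suc k) (U (x(p := y))) = y1 # info L' k x" for x
        unfolding info_Cons
        by (simp add: Up y1_def[symmetric] info_comp[of _ _ "\<lambda>x. U (x(p := y))"] L'_def[abs_def])
      show ?thesis
      proof (rule Suc.IH[where L = L' and \<phi> = \<phi>'])
        show "finite J" by fact
        show "s - y\<^sup>2 \<le> 1" using s zero_le_power2[of y] by linarith
        show "affine_on J (L' j ys)" if "j < k" for j ys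
        proof -
          have "affine_on I (\<lambda>x. L (Suc j) (y1 # ys) (U x))" using that by (intro Uaff aff) simp
          then obtain d l where dl: "\<And>x. L (Suc j) (y1 # ys) (U x) = d + (\<Sum>i\<in>I. l i * x i)"
            unfolding affine_on_def by blast
          have "L' j ys x = (d + l p * y) + (\<Sum>i\<in>J. l i * x i)" for x
          proof -
            have "(\<Sum>i\<in>J. l i * (x(p := y)) i) = (\<Sum>i\<in>J. l i * x i)"
              using J by (intro sum.cong) auto
            then show ?thesis unfolding L'_def dl IJ using J by simp
          qed
          then show ?thesis unfolding affine_on_def by blast
        qed
        show "(\<lambda>x. g (U (x(p := y)))) \<in> borel_measurable (lebP J)"
          by (rule measurable_compose[OF _ gU], rule measurable_fun_upd[where J = J]) (auto simp: IJ)
        show "ennreal (sqrt (ssq J (\<lambda>i. x i - \<phi>' (info L' k x) i))) \<le> g (U (x(p := y)))"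
          if x: "x \<in> space (lebP J)" and xs: "ssq J x < s - y\<^sup>2" for x
        proof -
          define x' where "x' = x(p := y)"
          define b where "b = \<phi>' (info L' k x)"
          have x's: "x' \<in> space (lebP I)" using x by (auto simp: IJ x'_def space_PiM PiE_def extensional_def)
          then have Ux: "U x' \<in> space (lebP I)" using Um by (rule measurable_space[rotated])
          have "ssq I (U x') < s" using xs unfolding Us unfolding IJ x'_def ssq_insert_upd[OF J] by simp
          then have "ennreal (sqrt (ssq I (\<lambda>i. U x' i - \<phi> (y1 # info L' k x) i))) \<le> g (U x')"
            using lower[OF Ux] by (simp only: inf x'_def)
          moreover have "ssq I (\<lambda>i. U x' i - \<phi> (y1 # info L' k x) i) = ssq I (\<lambda>i. U x' i - U b i)"
            unfolding ssq_def b_def using \<phi>' by (intro sum.cong) auto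
          \<comment> \<open>Forgetting the coordinate \<open>p\<close> can only decrease the
            error.\<close>
          moreover have "ssq I (\<lambda>i. x' i - b i) = (y - b p)\<^sup>2 + ssq J (\<lambda>i. x i - b i)"
            using J by (auto simp: ssq_def IJ x'_def intro!: sum.cong)
          then have "ssq J (\<lambda>i. x i - b i) \<le> ssq I (\<lambda>i. x' i - b i)" by simp
          ultimately show ?thesis
            unfolding x'_def[symmetric] b_def[symmetric] Ui
            by (metis ennreal_leI order.trans real_sqrt_le_mono)
        qed
      qed
    qed
    have "ennreal (real (card I - Suc k)) * ball_moment (card I - 1) s
        \<le> (\<integral>\<^sup>+y. ennreal (real (card J - k)) * ball_moment (card J - 1) (s - y\<^sup>2) \<partial>lborel)"
    \<comment> \<open>For empty \<open>J\<close> truncated subtraction makes both factors zero,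
      while \<open>ball_moment_slice\<close> asks for a nonempty set.\<close>
    proof (cases "J = {}")
      case True
      then show ?thesis by (simp add: cJ)
    next
      case False
      have "(\<integral>\<^sup>+y. ennreal (real (card J - k)) * ball_moment (card J - 1) (s - y\<^sup>2) \<partial>lborel)
          = ennreal (real (card J - k)) * ball_moment (card J) s"
        unfolding ball_moment_slice[OF J False] by (rule nn_integral_cmult) auto
      then show ?thesis by (simp add: cJ)
    qed
    also have "\<dots> \<le> (\<integral>\<^sup>+x. g x * ball_weight I s x \<partial>lebP I)"
      unfolding eq by (intro nn_integral_mono fibre)
    finally show ?thesis .
  qed
qed

section \<open>Lower bounds for randomized errors\<close>

text \<open>This transfers open sets of the space of all functions on \<open>nat\<close> to the
  product over \<open>I\<close>. On the latter space the coordinates outside \<open>I\<close> are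
  constantly \<open>undefined\<close>.\<close>

lemma identity_measurable_lebP: "(\<lambda>x. x) \<in> measurable (lebP I) (borel :: (nat \<Rightarrow> real) measure)"
proof (rule measurable_coordinatewise_then_product)
  fix i
  show "(\<lambda>x. x i) \<in> borel_measurable (lebP I)"
  proof (cases "i \<in> I")
    case False
    have "(\<lambda>x. x i) \<in> borel_measurable (lebP I) \<longleftrightarrow> (\<lambda>x. undefined :: real) \<in> borel_measurable (lebP I)"
      using False by (intro measurable_cong) (auto simp: space_PiM PiE_def extensional_def)
    then show ?thesis by simp
  qed measurable
qed

section \<open>Affine images of balls inside \<open>F\<close> and their measurability\<close>

locale ball_in_set =
  fixes F :: "'a::real_vector set" and I :: "nat set" and ctr :: 'a and a :: "nat \<Rightarrow> 'a"
  assumes finite_I: "finite I"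
    and ball: "\<And>x. ssq I x < 1 \<Longrightarrow> ctr + (\<Sum>i\<in>I. x i *\<^sub>R a i) \<in> F"
begin

definition emb :: "(nat \<Rightarrow> real) \<Rightarrow> 'a" where
  "emb x = ctr + (\<Sum>i\<in>I. x i *\<^sub>R a i)"

text \<open>Sending the points outside the open ball to the centre makes \<open>emb (clip x)\<close>
  an element of \<open>F\<close> for every \<open>x\<close>; the weight at squared radius 1 vanishes
  at those points.\<close>

definition clip :: "(nat \<Rightarrow> real) \<Rightarrow> nat \<Rightarrow> real" where
  "clip x = (if ssq I x < 1 then x else (\<lambda>_. 0))"

lemma emb_clip_in: "emb (clip x) \<in> F"
  unfolding emb_def clip_def by (rule ball) (auto simp: ssq_def)

text \<open>\<open>emb x - emb z\<close> is \<open>t\<close> times the difference of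
  \<open>emb ((x - z) / t)\<close> and the centre, both in \<open>F\<close> as soon as
  \<open>t\<close> exceeds the Euclidean distance of \<open>x\<close> and \<open>z\<close>. Hence
  that distance bounds the gauge of \<open>F - F\<close>, which is the continuity behind the
  measurability of \<open>emb\<close>.\<close>

lemma gauge_diff_emb_less:
  assumes "ssq I (\<lambda>i. x i - z i) < r\<^sup>2" "r > 0"
  shows "gauge_diff F (emb x - emb z) < ennreal r"
proof -
  define d where "d = sqrt (ssq I (\<lambda>i. x i - z i))"
  have nn: "0 \<le> ssq I (\<lambda>i. x i - z i)" by (simp add: ssq_def sum_nonneg)
  have d: "0 \<le> d" "d < r" "d\<^sup>2 = ssq I (\<lambda>i. x i - z i)"
    using assms nn by (auto simp: d_def intro!: real_less_lsqrt)
  define t where "t = (d + r) / 2"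
  have t: "0 < t" "d < t" "t < r" using d assms by (auto simp: t_def)
  define u where "u i = (x i - z i) / t" for i
  have "ssq I u = d\<^sup>2 / t\<^sup>2"
    unfolding d(3) by (simp add: ssq_def u_def power_divide sum_divide_distrib)
  also have "\<dots> < 1" using d(1) t by (simp add: power_strict_mono)
  finally have uF: "emb u \<in> F" unfolding emb_def by (rule ball)
  have "emb (\<lambda>_. 0) \<in> F" unfolding emb_def by (rule ball) (simp add: ssq_def)
  moreover have "emb x - emb z = t *\<^sub>R (emb u - emb (\<lambda>_. 0))"
    using t(1) by (simp add: emb_def u_def scaleR_sum_right sum_subtractf[symmetric] scaleR_diff_left[symmetric])
  ultimately have "emb x - emb z \<in> (\<lambda>z. t *\<^sub>R z) ` {f - g |f g. f \<in> F \<and> g \<in> F}"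
    using uF by blast
  then have "gauge_diff F (emb x - emb z) \<le> ennreal t"
    unfolding gauge_diff_def using t(1) by (intro INF_lower) auto
  also have "\<dots> < ennreal r" using t by (simp add: ennreal_lessI)
  finally show ?thesis .
qed

lemma emb_clip_measurable: "(\<lambda>x. emb (clip x)) \<in> measurable (lebP I) (borel_F F)"
  unfolding borel_F_def
proof (rule measurable_measure_of)
  show "(\<lambda>x. emb (clip x)) \<in> space (lebP I) \<rightarrow> F" using emb_clip_in by auto
  fix U assume "U \<in> {U. U \<subseteq> F \<and> (\<forall>f\<in>U. \<exists>r>0. \<forall>g\<in>F. gauge_diff F (g - f) < ennreal r \<longrightarrow> g \<in> U)}"
  then have U: "\<And>f. f \<in> U \<Longrightarrow> \<exists>r>0. \<forall>g\<in>F. gauge_diff F (g - f) < ennreal r \<longrightarrow> g \<in> U" by blast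
  \<comment> \<open>\<open>W\<close> lists centres and radii of gauge balls that stay in
    \<open>U\<close> within \<open>F\<close>. The Euclidean balls with the same data have an open
    union \<open>Q\<close>, which agrees with the preimage of \<open>U\<close> inside the unit
    ball.\<close>
  define W where "W = {(z, r). 0 < r \<and> (\<forall>g\<in>F. gauge_diff F (g - emb z) < ennreal r \<longrightarrow> g \<in> U)}"
  define Q where "Q = (\<Union>(z, r)\<in>W. {x. ssq I (\<lambda>i. x i - z i) < r\<^sup>2})"
  have "open Q"
    unfolding Q_def ssq_def
    by (intro open_UN ballI) (auto intro!: open_Collect_less continuous_intros split: prod.splits)
  then have [measurable]: "Q \<in> sets borel" by simp
  have Q: "emb x \<in> U \<longleftrightarrow> x \<in> Q" if x: "ssq I x < 1" for x
  proof
    assume "emb x \<in> U"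
    then obtain r where r: "r > 0" "\<forall>g\<in>F. gauge_diff F (g - emb x) < ennreal r \<longrightarrow> g \<in> U" using U by blast
    then have "(x, r) \<in> W" by (simp add: W_def)
    moreover have "ssq I (\<lambda>i. x i - x i) < r\<^sup>2" using r by (simp add: ssq_def)
    ultimately show "x \<in> Q" unfolding Q_def by (intro UN_I[of "(x, r)"]) auto
  next
    assume "x \<in> Q"
    then obtain z r where zr: "r > 0" "\<forall>g\<in>F. gauge_diff F (g - emb z) < ennreal r \<longrightarrow> g \<in> U"
      "ssq I (\<lambda>i. x i - z i) < r\<^sup>2" by (auto simp: Q_def W_def)
    have "emb x \<in> F" unfolding emb_def using x by (rule ball)
    then show "emb x \<in> U" using zr gauge_diff_emb_less[OF zr(3,1)] by blast
  qed
  have "(\<lambda>x. emb (clip x)) -` U \<inter> space (lebP I)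
      = {x \<in> space (lebP I). ssq I x < 1 \<and> x \<in> Q \<or> \<not> ssq I x < 1 \<and> emb (\<lambda>_. 0) \<in> U}"
    using Q by (auto simp: clip_def split: if_splits)
  also have "\<dots> \<in> sets (lebP I)"
  proof -
    have "{x \<in> space (lebP I). x \<in> Q} = (\<lambda>x. x) -` Q \<inter> space (lebP I)" by auto
    also have "\<dots> \<in> sets (lebP I)" by (rule measurable_sets[OF identity_measurable_lebP]) simp
    finally have [measurable]: "Measurable.pred (lebP I) (\<lambda>x. x \<in> Q)" by (simp add: pred_def)
    show ?thesis by measurable
  qed
  finally show "(\<lambda>x. emb (clip x)) -` U \<inter> space (lebP I) \<in> sets (lebP I)" .
qed blast

end

text \<open>The supremum over \<open>F\<close> is at least the average over the weighted ball.
  Exchanging the integrals leaves a deterministic adaptive algorithm for each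
  \<open>\<omega>\<close>; the coordinates \<open>\<mu> i\<close> turn its output into an
  approximation of the point \<open>x\<close> itself, with Euclidean error at most
  \<open>1 / s\<close> times the original one.\<close>

lemma e_ran_lower_bound:
  fixes S :: "'a::real_normed_vector \<Rightarrow> 'b::real_normed_vector"
  assumes S: "linear S"
    and ball: "\<And>x. ssq {..2 * k} x < 1 \<Longrightarrow> ctr + (\<Sum>i\<le>2 * k. x i *\<^sub>R a i) \<in> F"
    and \<mu>: "\<And>i. i \<le> 2 * k \<Longrightarrow> linear (\<mu> i)"
    and bess: "\<And>y. (\<Sum>i\<le>2 * k. (\<mu> i y)\<^sup>2) \<le> (norm y)\<^sup>2"
    and diag: "\<And>i j. i \<le> 2 * k \<Longrightarrow> j \<le> 2 * k \<Longrightarrow> \<mu> i (S (a j)) = (if i = j then \<sigma> i else (0::real))"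
    and \<sigma>: "0 < s" "\<And>i. i \<le> 2 * k \<Longrightarrow> s \<le> \<sigma> i"
  shows "ennreal (s / 2) \<le> e_ran TYPE('c) S F k"
  unfolding e_ran_def
proof (rule INF_greatest, clarify)
  fix M :: "'c measure" and L :: "'c \<Rightarrow> nat \<Rightarrow> real list \<Rightarrow> 'a \<Rightarrow> real" and phi :: "'c \<Rightarrow> real list \<Rightarrow> 'b"
  assume M: "prob_space M" and L: "\<forall>\<omega>\<in>space M. adaptive_info (L \<omega>) k"
    and meas: "(\<lambda>(f, \<omega>). norm (S f - phi \<omega> (info (L \<omega>) k f))) \<in> borel_measurable (borel_F F \<Otimes>\<^sub>M M)"
  interpret M: prob_space M by (rule M)
  define I where "I = {..2 * k}"
  interpret ball_in_set F I ctr a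
    by standard (auto simp: I_def intro: ball)
  interpret SI: sigma_finite_measure "lebP I" by (rule lebP.sigma_finite[OF finite_I])
  interpret PM: pair_sigma_finite "lebP I" M ..
  define err where "err f \<omega> = norm (S f - phi \<omega> (info (L \<omega>) k f))" for f \<omega>
  define E where "E = (SUP f\<in>F. \<integral>\<^sup>+\<omega>. ennreal (err f \<omega>) \<partial>M)"
  define G where "G x \<omega> = ennreal (err (emb (clip x)) \<omega>)" for x \<omega>
  have Gm [measurable]: "(\<lambda>(x, \<omega>). G x \<omega>) \<in> borel_measurable (lebP I \<Otimes>\<^sub>M M)"
  proof -
    have "(\<lambda>(x, \<omega>). (emb (clip x), \<omega>)) \<in> measurable (lebP I \<Otimes>\<^sub>M M) (borel_F F \<Otimes>\<^sub>M M)"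
      unfolding split_beta
      by (intro measurable_Pair measurable_compose[OF measurable_fst emb_clip_measurable] measurable_snd)
    from measurable_compose[OF this meas] show ?thesis
      unfolding G_def err_def by (simp add: split_beta)
  qed
  define Z where "Z = ball_mass (Suc (2 * k)) 1"
  have Z: "0 < Z" "Z < \<top>" unfolding Z_def by (rule ball_mass_pos_finite)+
  have tot: "(\<integral>\<^sup>+x. ball_weight I 1 x \<partial>lebP I) = Z"
    unfolding ball_weight_total[OF finite_I] by (simp add: I_def Z_def)
  have upper: "(\<integral>\<^sup>+x. \<integral>\<^sup>+\<omega>. G x \<omega> * ball_weight I 1 x \<partial>M \<partial>lebP I) \<le> E * Z"
  proof -
    have "(\<integral>\<^sup>+x. \<integral>\<^sup>+\<omega>. G x \<omega> * ball_weight I 1 x \<partial>M \<partial>lebP I) \<le> (\<integral>\<^sup>+x. E * ball_weight I 1 x \<partial>lebP I)"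
    proof (rule nn_integral_mono)
      fix x assume x: "x \<in> space (lebP I)"
      have "(\<integral>\<^sup>+\<omega>. G x \<omega> * ball_weight I 1 x \<partial>M) = (\<integral>\<^sup>+\<omega>. G x \<omega> \<partial>M) * ball_weight I 1 x"
        using x by (intro nn_integral_multc) measurable
      also have "\<dots> \<le> E * ball_weight I 1 x"
        unfolding G_def E_def by (intro mult_right_mono SUP_upper emb_clip_in) simp
      finally show "(\<integral>\<^sup>+\<omega>. G x \<omega> * ball_weight I 1 x \<partial>M) \<le> E * ball_weight I 1 x" .
    qed
    also have "\<dots> = E * Z" by (subst nn_integral_cmult) (auto simp: tot)
    finally show ?thesis .
  qed
  have fibre: "ennreal s * Z \<le> ennreal 2 * (\<integral>\<^sup>+x. G x \<omega> * ball_weight I 1 x \<partial>lebP I)" if \<omega>: "\<omega> \<in> space M" for \<omega>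
  proof -
    define L' where "L' = (\<lambda>j ys x. L \<omega> j ys (emb x))"
    \<comment> \<open>The equation \<open>\<mu> i w = \<mu> i (S ctr) + \<sigma> i * x i\<close> for
      the output \<open>w\<close>, solved for \<open>x i\<close>.\<close>
    define \<phi>' where "\<phi>' ys i = (\<mu> i (phi \<omega> ys) - \<mu> i (S ctr)) / \<sigma> i" for ys i
    have Gx [measurable]: "(\<lambda>x. G x \<omega>) \<in> borel_measurable (lebP I)" using \<omega> by measurable
    have "ennreal (real (card I - k)) * ball_moment (card I - 1) 1
      \<le> (\<integral>\<^sup>+x. (ennreal (1 / s) * G x \<omega>) * ball_weight I 1 x \<partial>lebP I)"
    proof (rule adaptive_average_error_lower[where L = L' and \<phi> = \<phi>'])
      show "finite I" by (rule finite_I)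
      show "affine_on I (L' j ys)" if "j < k" for j ys
      proof -
        have lin: "linear (L \<omega> j ys)"
          using L \<omega> that by (auto simp: adaptive_info_def dest: bounded_linear.linear)
        have "L' j ys x = L \<omega> j ys ctr + (\<Sum>i\<in>I. L \<omega> j ys (a i) * x i)" for x
          unfolding L'_def emb_def linear_add[OF lin] linear_sum[OF lin] linear_scale[OF lin] by (simp add: mult.commute)
        then show ?thesis unfolding affine_on_def by (intro exI allI)
      qed
      show "(\<lambda>x. ennreal (1 / s) * G x \<omega>) \<in> borel_measurable (lebP I)" by measurable
      fix x assume x: "ssq I x < 1"
      define w where "w = phi \<omega> (info (L \<omega>) k (emb x))"
      have inf: "info L' k x = info (L \<omega>) k (emb x)"
        unfolding L'_def by (rule info_comp[symmetric])
      have coord: "\<mu> i (S (emb x) - w) = \<mu> i (S ctr) - \<mu> i w + \<sigma> i * x i" if i: "i \<in> I" for i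
      proof -
        have i': "i \<le> 2 * k" using i by (simp add: I_def)
        have "\<mu> i (S (emb x)) = \<mu> i (S ctr) + (\<Sum>j\<in>I. x j * \<mu> i (S (a j)))"
          unfolding emb_def linear_add[OF S] linear_sum[OF S] linear_scale[OF S]
            linear_add[OF \<mu>[OF i']] linear_sum[OF \<mu>[OF i']] linear_scale[OF \<mu>[OF i']] by simp
        also have "(\<Sum>j\<in>I. x j * \<mu> i (S (a j))) = (\<Sum>j\<in>I. if i = j then \<sigma> i * x j else 0)"
          using i' by (intro sum.cong) (auto simp: diag I_def)
        also have "\<dots> = \<sigma> i * x i" using finite_I i by simp
        finally show ?thesis by (simp add: linear_diff[OF \<mu>[OF i']])
      qed
      have "s\<^sup>2 * ssq I (\<lambda>i. x i - \<phi>' (info L' k x) i) \<le> (\<Sum>i\<in>I. (\<mu> i (S (emb x) - w))\<^sup>2)"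
        unfolding ssq_def sum_distrib_left
      proof (rule sum_mono)
        fix i assume i: "i \<in> I"
        then have si: "0 < \<sigma> i" "s \<le> \<sigma> i" using \<sigma>(1) \<sigma>(2)[of i] by (auto simp: I_def)
        have "s\<^sup>2 * (x i - \<phi>' (info L' k x) i)\<^sup>2 \<le> (\<sigma> i)\<^sup>2 * (x i - \<phi>' (info L' k x) i)\<^sup>2"
          using si \<sigma>(1) by (intro mult_right_mono power_mono) auto
        also have "\<dots> = (\<sigma> i * (x i - \<phi>' (info L' k x) i))\<^sup>2" by (simp add: power_mult_distrib)
        also have "\<sigma> i * (x i - \<phi>' (info L' k x) i) = \<mu> i (S (emb x) - w)"
          unfolding coord[OF i] using si by (simp add: \<phi>'_def inf w_def[symmetric] field_simps)
        finally show "s\<^sup>2 * (x i - \<phi>' (info L' k x) i)\<^sup>2 \<le> (\<mu> i (S (emb x) - w))\<^sup>2" .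
      qed
      also have "\<dots> \<le> (norm (S (emb x) - w))\<^sup>2" unfolding I_def by (rule bess)
      finally have "sqrt (s\<^sup>2 * ssq I (\<lambda>i. x i - \<phi>' (info L' k x) i)) \<le> norm (S (emb x) - w)"
        by (intro real_le_lsqrt) auto
      then have "s * sqrt (ssq I (\<lambda>i. x i - \<phi>' (info L' k x) i)) \<le> norm (S (emb x) - w)"
        using \<sigma>(1) by (simp add: real_sqrt_mult)
      then have le: "sqrt (ssq I (\<lambda>i. x i - \<phi>' (info L' k x) i)) \<le> 1 / s * norm (S (emb x) - w)"
        using \<sigma>(1) by (simp add: field_simps)
      have "G x \<omega> = ennreal (norm (S (emb x) - w))"
        using x by (simp add: G_def err_def clip_def w_def)
      then show "ennreal (sqrt (ssq I (\<lambda>i. x i - \<phi>' (info L' k x) i))) \<le> ennreal (1 / s) * G x \<omega>"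
        using le \<sigma>(1) by (simp add: ennreal_mult[symmetric] ennreal_leI)
    qed simp
    also have "\<dots> = ennreal (1 / s) * (\<integral>\<^sup>+x. G x \<omega> * ball_weight I 1 x \<partial>lebP I)"
      unfolding mult.assoc by (rule nn_integral_cmult) measurable
    finally have *: "ennreal (real (k + 1)) * ball_moment (2 * k) 1 \<le> ennreal (1 / s) * (\<integral>\<^sup>+x. G x \<omega> * ball_weight I 1 x \<partial>lebP I)"
      by (simp add: I_def)
    \<comment> \<open>In dimension \<open>2 k + 1\<close>, \<open>k\<close> measurements leave
      \<open>k + 1\<close> coordinates, each with mean square \<open>1 / (2 k + 2)\<close>; together
      they make exactly one half of the mass.\<close>
    have "Z = ennreal 2 * (ennreal (real (k + 1)) * ball_moment (2 * k) 1)"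
      unfolding Z_def ball_moment_mass[symmetric] mult.assoc[symmetric] ennreal_mult'[OF zero_le_numeral, symmetric]
      by (simp add: algebra_simps)
    also have "\<dots> \<le> ennreal 2 * (ennreal (1 / s) * (\<integral>\<^sup>+x. G x \<omega> * ball_weight I 1 x \<partial>lebP I))"
      by (intro mult_left_mono *) simp
    finally have "ennreal s * Z \<le> ennreal s * (ennreal 2 * (ennreal (1 / s) * (\<integral>\<^sup>+x. G x \<omega> * ball_weight I 1 x \<partial>lebP I)))"
      by (rule mult_left_mono) simp
    also have "\<dots> = (ennreal s * ennreal (1 / s)) * (ennreal 2 * (\<integral>\<^sup>+x. G x \<omega> * ball_weight I 1 x \<partial>lebP I))"
      by (simp add: mult_ac)
    also have "ennreal s * ennreal (1 / s) = 1" using \<sigma>(1) by (simp add: ennreal_mult[symmetric])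
    finally show ?thesis by simp
  qed
  have "ennreal s * Z = (\<integral>\<^sup>+\<omega>. ennreal s * Z \<partial>M)" by (simp add: M.emeasure_space_1)
  also have "\<dots> \<le> (\<integral>\<^sup>+\<omega>. ennreal 2 * (\<integral>\<^sup>+x. G x \<omega> * ball_weight I 1 x \<partial>lebP I) \<partial>M)"
    by (intro nn_integral_mono fibre)
  also have "\<dots> = ennreal 2 * (\<integral>\<^sup>+\<omega>. \<integral>\<^sup>+x. G x \<omega> * ball_weight I 1 x \<partial>lebP I \<partial>M)"
    by (rule nn_integral_cmult) measurable
  also have "(\<integral>\<^sup>+\<omega>. \<integral>\<^sup>+x. G x \<omega> * ball_weight I 1 x \<partial>lebP I \<partial>M) = (\<integral>\<^sup>+x. \<integral>\<^sup>+\<omega>. G x \<omega> * ball_weight I 1 x \<partial>M \<partial>lebP I)"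
    by (rule PM.Fubini') measurable
  also have "ennreal 2 * \<dots> \<le> ennreal 2 * (E * Z)"
    by (intro mult_left_mono upper) simp
  finally have "Z * ennreal s \<le> Z * (ennreal 2 * E)" by (simp add: mult_ac)
  \<comment> \<open>Cancellation is possible because \<open>Z\<close> is positive and
    finite.\<close>
  then have "ennreal s \<le> ennreal 2 * E"
    using Z by (simp add: ennreal_mult_le_mult_iff)
  moreover have "ennreal 2 * ennreal (s / 2) = ennreal s"
    using \<sigma>(1) by (subst ennreal_mult[symmetric]) auto
  ultimately have "ennreal 2 * ennreal (s / 2) \<le> ennreal 2 * E" by simp
  then have "ennreal (s / 2) \<le> E"
    by (subst (asm) ennreal_mult_le_mult_iff) auto
  then show "ennreal (s / 2) \<le> (SUP f\<in>F. \<integral>\<^sup>+\<omega>. ennreal (norm (S f - phi \<omega> (info (L \<omega>) k f))) \<partial>M)"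
    unfolding E_def err_def .
qed

section \<open>Comparison of the error products\<close>

text \<open>The algorithm tested here answers with \<open>S\<close> at some element of
  \<open>F\<close> that has the same information as the input. A point where its error exceeds
  \<open>c\<close>, together with the representative of that point, is the desired pair.\<close>

lemma e_det_non_witness:
  fixes S :: "'a::real_normed_vector \<Rightarrow> 'b::real_normed_vector" and L :: "nat \<Rightarrow> 'a \<Rightarrow> real"
  assumes c: "c < e_det_non S F k" and L: "\<And>i. i < k \<Longrightarrow> bounded_linear (L i)"
  shows "\<exists>f\<in>F. \<exists>g\<in>F. (\<forall>i<k. L i f = L i g) \<and> c < ennreal (norm (S f - S g))"
proof -
  define obs where "obs f = map (\<lambda>i. L i f) [0..<k]" for f
  define rep where "rep ys = (SOME g. g \<in> F \<and> obs g = ys)" for ys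
  have "e_det_non S F k \<le> wc_error S F (\<lambda>f. S (rep (obs f)))"
    unfolding e_det_non_def obs_def
    by (rule INF_lower2[where i = "(L, \<lambda>ys. S (rep ys))"]) (use L in auto)
  with c have "c < (SUP f\<in>F. ennreal (norm (S f - S (rep (obs f)))))"
    unfolding wc_error_def by order
  then obtain f where f: "f \<in> F" "c < ennreal (norm (S f - S (rep (obs f))))"
    by (auto simp: less_SUP_iff)
  have "rep (obs f) \<in> F \<and> obs (rep (obs f)) = obs f"
    unfolding rep_def by (rule someI[of _ f]) (use f in auto)
  moreover from this have "L i f = L i (rep (obs f))" if "i < k" for i
    using that by (auto simp: obs_def)
  ultimately show ?thesis using f by blast
qed

text \<open>The \<open>k\<close>-th pair is chosen indistinguishable by the functionals attached to
  the earlier differences, composed with \<open>S\<close>. These \<open>k\<close> functionals form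
  an admissible non-adaptive information, so the pair can still be separated by more than
  \<open>c k\<close>.\<close>

lemma greedy_sequences:
  fixes nf :: "'b::real_normed_vector \<Rightarrow> 'b \<Rightarrow> real"
  assumes S: "bounded_linear S" and nf: "\<And>y. bounded_linear (nf y)"
    and c: "\<And>k. k < N \<Longrightarrow> 0 \<le> c k \<and> ennreal (c k) < e_det_non S F k"
  shows "\<exists>f g. \<forall>k<N. f k \<in> F \<and> g k \<in> F \<and> c k < norm (S (f k - g k))
    \<and> (\<forall>i<k. nf (S (f i - g i)) (S (f k - g k)) = 0)"
  using c
proof (induction N)
  case (Suc N)
  then obtain f g where fg: "\<And>k. k < N \<Longrightarrow> f k \<in> F \<and> g k \<in> F \<and> c k < norm (S (f k - g k))
    \<and> (\<forall>i<k. nf (S (f i - g i)) (S (f k - g k)) = 0)" by (metis less_Suc_eq)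
  interpret S: bounded_linear S by (rule S)
  define L where "L i x = nf (S (f i - g i)) (S x)" for i x
  have L: "bounded_linear (L i)" for i
    unfolding L_def by (rule bounded_linear_compose[OF nf S])
  have cN: "0 \<le> c N" "ennreal (c N) < e_det_non S F N" using Suc.prems[of N] by auto
  obtain f' g' where f': "f' \<in> F" "g' \<in> F" "\<And>i. i < N \<Longrightarrow> L i f' = L i g'"
    "ennreal (c N) < ennreal (norm (S f' - S g'))"
    using e_det_non_witness[OF cN(2), of L] L by blast
  have "c N < norm (S (f' - g'))" using f'(4) cN(1) by (simp add: S.diff ennreal_less_iff)
  moreover have "nf (S (f i - g i)) (S (f' - g')) = 0" if "i < N" for i
    using f'(3)[OF that] by (simp add: L_def S.diff linear_diff[OF bounded_linear.linear[OF nf]])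
  ultimately show ?case using fg f'(1,2)
    by (intro exI[of _ "f(N := f')"] exI[of _ "g(N := g')"]) (auto simp: less_Suc_eq)
qed simp

lemma prod_lessThan_pairs:
  fixes f :: "nat \<Rightarrow> 'a::comm_monoid_mult"
  shows "(\<Prod>j<2 * n. f j) = (\<Prod>k<n. f (2 * k) * f (Suc (2 * k)))"
  by (induction n) (simp_all add: mult.assoc)

text \<open>\<open>\<alpha>\<close> is the scale at which a Euclidean ball fits into
  \<open>F\<close> along the \<open>h l\<close>, and \<open>\<beta>\<close> bounds the map into
  Euclidean space given by the \<open>\<xi> l\<close>. Putting \<open>\<alpha> / \<beta>\<close>
  into \<open>T\<close> makes both maps fit \<open>e_ran_lower_bound\<close>; the inverse quotient
  reappears in the constant.\<close>

lemma determinant_lower_bound: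
  fixes S :: "'a::real_normed_vector \<Rightarrow> 'b::real_normed_vector"
  assumes S: "linear S" and \<xi>: "\<And>l. l < 2 * n \<Longrightarrow> linear (\<xi> l :: 'b \<Rightarrow> real)"
    and tri: "\<And>i k. i < k \<Longrightarrow> k < 2 * n \<Longrightarrow> \<xi> i (S (h k)) = 0"
    and c: "\<And>k. k < 2 * n \<Longrightarrow> 0 < c k \<and> c k \<le> \<xi> k (S (h k))"
    and \<alpha>\<beta>: "0 < \<alpha>" "0 < \<beta>"
    and bess: "\<And>y. (\<Sum>l<2 * n. (\<xi> l y)\<^sup>2) \<le> \<beta>\<^sup>2 * (norm y)\<^sup>2"
    and ball: "\<And>x. (\<Sum>l<2 * n. (x l)\<^sup>2) \<le> 1 \<Longrightarrow> ctr + \<alpha> *\<^sub>R (\<Sum>l<2 * n. x l *\<^sub>R h l) \<in> F"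
  shows "ennreal (\<Prod>k<2 * n. c k) \<le> ennreal ((2 * \<beta> / \<alpha>) ^ (2 * n)) * (\<Prod>k<n. e_ran TYPE('c) S F k)\<^sup>2"
proof -
  define N where "N = 2 * n"
  define T where "T i j = \<alpha> / \<beta> * \<xi> i (S (h j))" for i j
  obtain v where v: "orthonormal_fam N v N"
    and orth: "\<And>l m. l < N \<Longrightarrow> m < N \<Longrightarrow> l \<noteq> m \<Longrightarrow> dot N (mapp N T (v l)) (mapp N T (v m)) = 0"
    and mono: "\<And>l m. l \<le> m \<Longrightarrow> m < N \<Longrightarrow> dot N (mapp N T (v m)) (mapp N T (v m)) \<le> dot N (mapp N T (v l)) (mapp N T (v l))"
    and det: "(\<Prod>j<N. dot N (mapp N T (v j)) (mapp N T (v j))) = (\<Prod>j<N. (T j j)\<^sup>2)"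
    using singular_value_decomposition_lower_triangular[of N T] tri by (auto simp: T_def N_def)
  define \<sigma> where "\<sigma> j = sqrt (dot N (mapp N T (v j)) (mapp N T (v j)))" for j
  have Tpos: "0 < T j j" if "j < N" for j
    using c[of j] that \<alpha>\<beta> by (auto simp: T_def N_def intro!: mult_pos_pos)
  have "0 < (\<Prod>j<N. (T j j)\<^sup>2)" using Tpos by (intro prod_pos) (auto simp: less_imp_neq[symmetric])
  then have "(\<Prod>j<N. dot N (mapp N T (v j)) (mapp N T (v j))) \<noteq> 0"
    unfolding det by (rule less_imp_neq[symmetric])
  then have "dot N (mapp N T (v j)) (mapp N T (v j)) \<noteq> 0" if "j < N" for j
    using that by (simp add: prod_zero_iff)
  then have \<sigma>pos: "0 < \<sigma> j" if "j < N" for j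
    using that dot_nonneg[of N "mapp N T (v j)"] by (auto simp: \<sigma>_def less_le)
  have \<sigma>sq: "\<sigma> j * \<sigma> j = dot N (mapp N T (v j)) (mapp N T (v j))" for j
    using dot_nonneg[of N "mapp N T (v j)"] by (simp add: \<sigma>_def)
  have \<sigma>mono: "\<sigma> m \<le> \<sigma> l" if "l \<le> m" "m < N" for l m
    using mono[OF that] by (simp add: \<sigma>_def)
  have \<sigma>prod: "(\<Prod>j<N. \<sigma> j) = (\<Prod>j<N. T j j)"
  proof (rule power2_eq_imp_eq)
    show "(\<Prod>j<N. \<sigma> j)\<^sup>2 = (\<Prod>j<N. T j j)\<^sup>2"
      unfolding prod_power_distrib det[symmetric] \<sigma>sq[symmetric] by (simp add: power2_eq_square)
  qed (use Tpos \<sigma>pos in \<open>auto intro!: less_imp_le prod_pos\<close>)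
  define u where "u i l = mapp N T (v i) l / \<sigma> i" for i l
  have du: "dot N (u i) y = dot N (mapp N T (v i)) y / \<sigma> i" "dot N y (u i) = dot N y (mapp N T (v i)) / \<sigma> i" for i y
    by (simp_all add: dot_def u_def sum_divide_distrib)
  have u: "orthonormal_fam N u N"
    unfolding orthonormal_fam_def du using orth \<sigma>pos by (auto simp: \<sigma>sq[symmetric] less_imp_neq[symmetric])
  have ran: "ennreal (\<sigma> (2 * k) / 2) \<le> e_ran TYPE('c) S F k" if k: "k < n" for k
  proof -
    have kN: "Suc (2 * k) \<le> N" using k by (simp add: N_def)
    then have iN: "i < N" if "i \<le> 2 * k" for i using that by simp
    have vk: "orthonormal_fam N v (Suc (2 * k))" and uk: "orthonormal_fam N u (Suc (2 * k))"
      using u v kN by (auto simp: orthonormal_fam_def)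
    \<comment> \<open>The \<open>a i\<close> are right singular vectors carried into the input
      space, the \<open>\<mu> i\<close> are left singular coordinates of
      \<open>y \<mapsto> \<xi> l y / \<beta>\<close>; with respect to these \<open>S\<close> acts
      diagonally with entries \<open>\<sigma> i\<close>.\<close>
    define a where "a i = \<alpha> *\<^sub>R (\<Sum>l<N. v i l *\<^sub>R h l)" for i
    define \<mu> where "\<mu> i y = (\<Sum>l<N. \<xi> l y / \<beta> * u i l)" for i y
    show ?thesis
    proof (rule e_ran_lower_bound[where ctr = ctr and a = a and \<mu> = \<mu> and \<sigma> = \<sigma>, OF S])
      fix x :: "nat \<Rightarrow> real" assume x: "ssq {..2 * k} x < 1"
      \<comment> \<open>Parseval's identity, as \<open>dot_diff_proj\<close> at the zero
        vector.\<close>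
      have "(\<Sum>l<N. (\<Sum>i\<le>2 * k. x i * v i l)\<^sup>2) = (\<Sum>i\<le>2 * k. (x i)\<^sup>2)"
        using dot_diff_proj[OF vk, of "\<lambda>_. 0" x]
        by (simp add: dot_def power2_eq_square lessThan_Suc_atMost)
      then have "ctr + \<alpha> *\<^sub>R (\<Sum>l<N. (\<Sum>i\<le>2 * k. x i * v i l) *\<^sub>R h l) \<in> F"
        using x ball[of "\<lambda>l. \<Sum>i\<le>2 * k. x i * v i l"] by (simp add: ssq_def N_def)
      moreover have "(\<Sum>i\<le>2 * k. x i *\<^sub>R a i) = \<alpha> *\<^sub>R (\<Sum>l<N. (\<Sum>i\<le>2 * k. x i * v i l) *\<^sub>R h l)"
        unfolding a_def scaleR_sum_left scaleR_sum_right by (subst sum.swap) (simp add: mult_ac)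
      ultimately show "ctr + (\<Sum>i\<le>2 * k. x i *\<^sub>R a i) \<in> F" by simp
    next
      fix i assume "i \<le> 2 * k"
      show "linear (\<mu> i)"
        unfolding \<mu>_def using \<xi>
        by (intro linearI)
           (auto simp: N_def linear_add linear_scale sum_distrib_left sum.distrib[symmetric] add_divide_distrib
              algebra_simps intro!: sum.cong)
    next
      fix y :: 'b
      have "(\<Sum>i\<le>2 * k. (\<mu> i y)\<^sup>2) = (\<Sum>i<Suc (2 * k). (dot N (\<lambda>l. \<xi> l y / \<beta>) (u i))\<^sup>2)"
        by (simp add: \<mu>_def dot_def lessThan_Suc_atMost)
      also have "\<dots> \<le> dot N (\<lambda>l. \<xi> l y / \<beta>) (\<lambda>l. \<xi> l y / \<beta>)" by (rule bessel_fam[OF uk])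
      also have "\<dots> = (\<Sum>l<N. (\<xi> l y)\<^sup>2) / \<beta>\<^sup>2"
        by (simp add: dot_def power2_eq_square sum_divide_distrib)
      also have "\<dots> \<le> (norm y)\<^sup>2"
        using bess[of y] \<alpha>\<beta> by (simp add: N_def divide_le_eq mult.commute)
      finally show "(\<Sum>i\<le>2 * k. (\<mu> i y)\<^sup>2) \<le> (norm y)\<^sup>2" .
    next
      fix i j assume ij: "i \<le> 2 * k" "j \<le> 2 * k"
      have "\<xi> l (S (a j)) / \<beta> = mapp N T (v j) l" if "l < N" for l
      proof -
        have l: "linear (\<xi> l)" using that \<xi> by (simp add: N_def)
        show ?thesis
          unfolding a_def mapp_def T_def linear_scale[OF S] linear_sum[OF S] linear_scale[OF l] linear_sum[OF l]
          by (simp add: sum_distrib_left sum_divide_distrib mult_ac)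
      qed
      then have "\<mu> i (S (a j)) = dot N (mapp N T (v j)) (u i)" by (simp add: \<mu>_def dot_def)
      also have "\<dots> = (if i = j then \<sigma> i else 0)"
        unfolding du using orth[OF iN[OF ij(2)] iN[OF ij(1)]] \<sigma>pos[OF iN[OF ij(1)]]
        by (auto simp: \<sigma>sq[symmetric])
      finally show "\<mu> i (S (a j)) = (if i = j then \<sigma> i else 0)" .
    next
      show "0 < \<sigma> (2 * k)" using \<sigma>pos kN by simp
      show "\<sigma> (2 * k) \<le> \<sigma> i" if "i \<le> 2 * k" for i using \<sigma>mono[OF that] kN by simp
    qed
  qed
  define p where "p = (\<Prod>k<n. \<sigma> (2 * k) / 2)"
  have p0: "0 \<le> p" unfolding p_def using \<sigma>pos by (intro prod_nonneg) (auto simp: N_def intro!: less_imp_le)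
  have "ennreal p = (\<Prod>k<n. ennreal (\<sigma> (2 * k) / 2))"
    unfolding p_def using \<sigma>pos by (intro prod_ennreal[symmetric]) (auto simp: N_def intro!: less_imp_le)
  also have "\<dots> \<le> (\<Prod>k<n. e_ran TYPE('c) S F k)"
    using ran by (intro prod_mono_ennreal) auto
  finally have p_le: "ennreal p \<le> (\<Prod>k<n. e_ran TYPE('c) S F k)" .
  have "(\<Prod>k<N. c k) \<le> (\<Prod>k<N. \<beta> / \<alpha> * T k k)"
    using c \<alpha>\<beta> by (intro prod_mono) (auto simp: T_def N_def less_imp_le)
  also have "\<dots> = (\<beta> / \<alpha>) ^ N * (\<Prod>j<N. \<sigma> j)"
    unfolding \<sigma>prod prod.distrib by simp
  also have "(\<Prod>j<N. \<sigma> j) = (\<Prod>k<n. \<sigma> (2 * k) * \<sigma> (Suc (2 * k)))"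
    unfolding N_def by (rule prod_lessThan_pairs)
  \<comment> \<open>Each singular value of odd index is replaced by its predecessor, so that only
    even indices remain, the ones that \<open>ran\<close> compares with randomized errors. The
    factors 4 compensate the halves in \<open>ran\<close>.\<close>
  also have "(\<beta> / \<alpha>) ^ N * \<dots> \<le> (\<beta> / \<alpha>) ^ N * (\<Prod>k<n. 4 * (\<sigma> (2 * k) / 2)\<^sup>2)"
  proof (intro mult_left_mono prod_mono conjI)
    fix k assume "k \<in> {..<n}"
    then have k: "2 * k < N" "Suc (2 * k) < N" by (auto simp: N_def)
    show "0 \<le> \<sigma> (2 * k) * \<sigma> (Suc (2 * k))" using \<sigma>pos k by (simp add: less_imp_le)
    have "\<sigma> (2 * k) * \<sigma> (Suc (2 * k)) \<le> \<sigma> (2 * k) * \<sigma> (2 * k)"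
      using \<sigma>pos[OF k(1)] \<sigma>mono[OF _ k(2), of "2 * k"] by (intro mult_left_mono) auto
    then show "\<sigma> (2 * k) * \<sigma> (Suc (2 * k)) \<le> 4 * (\<sigma> (2 * k) / 2)\<^sup>2"
      by (simp add: power2_eq_square)
  qed (use \<alpha>\<beta> in auto)
  also have "(\<Prod>k<n. 4 * (\<sigma> (2 * k) / 2)\<^sup>2) = 2 ^ N * p\<^sup>2"
    unfolding p_def prod.distrib prod_power_distrib N_def power_mult by simp
  also have "(\<beta> / \<alpha>) ^ N * (2 ^ N * p\<^sup>2) = (2 * \<beta> / \<alpha>) ^ N * p\<^sup>2"
    by (simp add: power_mult_distrib[symmetric] mult_ac flip: mult.assoc)
  finally have "(\<Prod>k<N. c k) \<le> (2 * \<beta> / \<alpha>) ^ N * p\<^sup>2" .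
  then have "ennreal (\<Prod>k<N. c k) \<le> ennreal ((2 * \<beta> / \<alpha>) ^ N) * (ennreal p)\<^sup>2"
    using \<alpha>\<beta> p0 by (simp add: ennreal_power ennreal_mult[symmetric] ennreal_leI)
  also have "\<dots> \<le> ennreal ((2 * \<beta> / \<alpha>) ^ N) * (\<Prod>k<n. e_ran TYPE('c) S F k)\<^sup>2"
    by (intro mult_left_mono power_mono p_le) auto
  finally show ?thesis unfolding N_def .
qed

section \<open>Passing from strict real lower bounds to suprema and roots\<close>

lemma ennreal_mult_le_of_real_below:
  fixes b e X :: ennreal
  assumes "\<And>r. 0 < r \<Longrightarrow> ennreal r < e \<Longrightarrow> b * ennreal r \<le> X"
  shows "b * e \<le> X"
proof (cases "e = 0")
  case False
  define R where "R = {r. 0 < r \<and> ennreal r < e}"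
  have ex: "\<exists>r\<in>R. x \<le> ennreal r" if x: "x < e" for x
  proof -
    obtain y where y: "x < y" "y < e" using dense[OF x] by blast
    then obtain r where r: "0 \<le> r" "y = ennreal r" by (cases y) auto
    then have "0 < r" using y by (cases "r = 0") auto
    then show ?thesis using y r by (intro bexI[of _ r]) (auto simp: R_def)
  qed
  have "R \<noteq> {}" using ex[of 0] False by (auto simp: zero_less_iff_neq_zero)
  have "e \<le> (SUP r\<in>R. ennreal r)"
  proof (rule dense_le)
    fix x assume "x < e"
    with ex obtain r where "r \<in> R" "x \<le> ennreal r" by blast
    then show "x \<le> (SUP r\<in>R. ennreal r)" by (rule SUP_upper2)
  qed
  then have "b * e \<le> b * (SUP r\<in>R. ennreal r)" by (rule mult_left_mono) simp
  also have "\<dots> = (SUP r\<in>R. b * ennreal r)" by (rule SUP_mult_left_ennreal)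
  also have "\<dots> \<le> X" using assms by (intro SUP_least) (auto simp: R_def)
  finally show ?thesis .
qed simp

text \<open>The factors are replaced one at a time, with \<open>b\<close> collecting those already
  turned into reals. A zero factor leaves no admissible \<open>c\<close> but makes the product zero;
  an infinite factor is reached as a supremum.\<close>

lemma ennreal_prod_le_of_real_below:
  fixes e :: "'i \<Rightarrow> ennreal"
  assumes "finite K"
    and "\<And>c. (\<And>k. k \<in> K \<Longrightarrow> 0 < c k \<and> ennreal (c k) < e k) \<Longrightarrow> b * ennreal (\<Prod>k\<in>K. c k) \<le> X"
  shows "b * (\<Prod>k\<in>K. e k) \<le> X"
  using assms
proof (induction K arbitrary: b rule: finite_induct)
  case empty
  from empty[of "\<lambda>_. 0"] show ?case by simp
next
  case (insert i K)
  have "(b * (\<Prod>k\<in>K. e k)) * e i \<le> X"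
  proof (rule ennreal_mult_le_of_real_below)
    fix r :: real assume r: "0 < r" "ennreal r < e i"
    have "(b * ennreal r) * (\<Prod>k\<in>K. e k) \<le> X"
    proof (rule insert.IH)
      fix c assume c: "\<And>k. k \<in> K \<Longrightarrow> 0 < c k \<and> ennreal (c k) < e k"
      define c' where "c' = c(i := r)"
      have "b * ennreal (\<Prod>k\<in>insert i K. c' k) \<le> X"
        using c r by (intro insert.prems) (auto simp: c'_def)
      moreover have "(\<Prod>k\<in>insert i K. c' k) = r * (\<Prod>k\<in>K. c k)"
        using insert.hyps by (auto simp: c'_def intro!: prod.cong)
      moreover have "0 \<le> (\<Prod>k\<in>K. c k)" using c by (intro prod_nonneg) (auto intro: less_imp_le)
      ultimately show "b * ennreal r * ennreal (\<Prod>k\<in>K. c k) \<le> X"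
        using r by (simp add: ennreal_mult mult.assoc)
    qed
    then show "b * (\<Prod>k\<in>K. e k) * ennreal r \<le> X" by (simp add: mult_ac)
  qed
  then show ?case using insert.hyps by (simp add: mult_ac)
qed

lemma eroot_le_eroot:
  assumes n: "n \<ge> 1" and C: "0 < C" and le: "X \<le> ennreal (C ^ (2 * n)) * Y\<^sup>2"
  shows "eroot (2 * n) X \<le> ennreal C * eroot n Y"
proof (cases "Y = \<top>")
  case True
  then show ?thesis using C by (simp add: eroot_def ennreal_mult_top)
next
  case False
  then obtain y where y: "0 \<le> y" "Y = ennreal y" by (cases Y) auto
  have X: "X \<le> ennreal (C ^ (2 * n) * y\<^sup>2)"
    using le C y by (simp add: ennreal_power ennreal_mult)
  then obtain x where x: "0 \<le> x" "X = ennreal x" by (cases X) (auto simp: top_unique)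
  have xy: "x \<le> C ^ (2 * n) * y\<^sup>2" using X x C y by (simp add: ennreal_le_iff)
  have "(C * root n y) ^ (2 * n) = C ^ (2 * n) * (root n y ^ n)\<^sup>2"
    by (simp add: power_mult_distrib power_mult[symmetric] mult.commute)
  also have "root n y ^ n = y" using n y by simp
  finally have "root (2 * n) (C ^ (2 * n) * y\<^sup>2) = C * root n y"
    using n C y by (intro real_root_pos_unique) auto
  then have "root (2 * n) x \<le> C * root n y"
    using xy n by (metis mult_is_0 not_one_le_zero real_root_le_mono zero_neq_numeral neq0_conv)
  then show ?thesis using x y C n by (simp add: eroot_def ennreal_mult[symmetric] ennreal_leI)
qed

text \<open>All dependence on the geometry of \<open>F\<close> and of the target space is condensed
  into \<open>\<alpha>\<close> and \<open>\<beta>\<close>. The Bessel bound is demanded only for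
  nonzero families with the triangular condition, which is what the greedy choice delivers and the
  Hilbert space case exploits.\<close>

lemma error_product_comparison:
  fixes S :: "'a::real_normed_vector \<Rightarrow> 'b::real_normed_vector"
    and nf :: "'b \<Rightarrow> 'b \<Rightarrow> real"
  assumes S: "bounded_linear S" and n: "n \<ge> 1" and \<alpha>\<beta>: "0 < \<alpha>" "0 < \<beta>"
    and nf: "\<And>y. bounded_linear (nf y)" "\<And>y. nf y y = norm y"
    and bess: "\<And>w y. (\<And>k. k < 2 * n \<Longrightarrow> w k \<noteq> 0) \<Longrightarrow> (\<And>i k. i < k \<Longrightarrow> k < 2 * n \<Longrightarrow> nf (w i) (w k) = 0) \<Longrightarrow>
      (\<Sum>l<2 * n. (nf (w l) y)\<^sup>2) \<le> \<beta>\<^sup>2 * (norm y)\<^sup>2"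
    and ball: "\<And>f g. (\<And>k. k < 2 * n \<Longrightarrow> f k \<in> F \<and> g k \<in> F) \<Longrightarrow>
      \<exists>ctr. \<forall>x. (\<Sum>l<2 * n. (x l)\<^sup>2) \<le> 1 \<longrightarrow> ctr + \<alpha> *\<^sub>R (\<Sum>l<2 * n. x l *\<^sub>R (f l - g l)) \<in> F"
  shows "eroot (2 * n) (\<Prod>k<2 * n. e_det_non S F k)
    \<le> ennreal (2 * \<beta> / \<alpha>) * eroot n (\<Prod>k<n. e_ran TYPE('c) S F k)"
proof (rule eroot_le_eroot[OF n])
  show "0 < 2 * \<beta> / \<alpha>" using \<alpha>\<beta> by simp
  have "1 * (\<Prod>k<2 * n. e_det_non S F k)
    \<le> ennreal ((2 * \<beta> / \<alpha>) ^ (2 * n)) * (\<Prod>k<n. e_ran TYPE('c) S F k)\<^sup>2"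
  proof (rule ennreal_prod_le_of_real_below)
    fix c assume "\<And>k. k \<in> {..<2 * n} \<Longrightarrow> 0 < c k \<and> ennreal (c k) < e_det_non S F k"
    then have c: "\<And>k. k < 2 * n \<Longrightarrow> 0 < c k" "\<And>k. k < 2 * n \<Longrightarrow> ennreal (c k) < e_det_non S F k" by auto
    have "\<exists>f g. \<forall>k<2 * n. f k \<in> F \<and> g k \<in> F \<and> c k < norm (S (f k - g k))
        \<and> (\<forall>i<k. nf (S (f i - g i)) (S (f k - g k)) = 0)"
      by (rule greedy_sequences[OF S nf(1)]) (use c in \<open>auto intro: less_imp_le\<close>)
    then obtain f g where fg: "\<And>k. k < 2 * n \<Longrightarrow> f k \<in> F \<and> g k \<in> F"
      and cfg: "\<And>k. k < 2 * n \<Longrightarrow> c k < norm (S (f k - g k))"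
      and tri: "\<And>i k. i < k \<Longrightarrow> k < 2 * n \<Longrightarrow> nf (S (f i - g i)) (S (f k - g k)) = 0"
      by blast
    obtain ctr where ctr: "\<And>x. (\<Sum>l<2 * n. (x l)\<^sup>2) \<le> 1 \<Longrightarrow> ctr + \<alpha> *\<^sub>R (\<Sum>l<2 * n. x l *\<^sub>R (f l - g l)) \<in> F"
      using ball[of f g] fg by blast
    have ne: "S (f k - g k) \<noteq> 0" if "k < 2 * n" for k
      using c(1)[OF that] cfg[OF that] by auto
    have "ennreal (\<Prod>k<2 * n. c k) \<le> ennreal ((2 * \<beta> / \<alpha>) ^ (2 * n)) * (\<Prod>k<n. e_ran TYPE('c) S F k)\<^sup>2"
      by (rule determinant_lower_bound[where \<xi> = "\<lambda>l. nf (S (f l - g l))" and h = "\<lambda>l. f l - g l" and ctr = ctr])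
         (use S nf tri c cfg \<alpha>\<beta> bess[of "\<lambda>l. S (f l - g l)", OF ne tri] ctr in
           \<open>auto simp: bounded_linear.linear less_imp_le\<close>)
    then show "1 * ennreal (\<Prod>k<2 * n. c k) \<le> ennreal ((2 * \<beta> / \<alpha>) ^ (2 * n)) * (\<Prod>k<n. e_ran TYPE('c) S F k)\<^sup>2"
      by simp
  qed simp
  then show "(\<Prod>k<2 * n. e_det_non S F k)
    \<le> ennreal ((2 * \<beta> / \<alpha>) ^ (2 * n)) * (\<Prod>k<n. e_ran TYPE('c) S F k)\<^sup>2" by simp
qed

section \<open>Euclidean balls inside convex sets, and families of norming functionals\<close>

lemma ball_embedding_symmetric:
  fixes F :: "'a::real_vector set" and N :: nat
  assumes F: "convex F" "symmetric_set F" and N: "N \<ge> 1"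
    and fg: "\<And>k. k < N \<Longrightarrow> f k \<in> F \<and> g k \<in> F" and x: "(\<Sum>l<N. (x l)\<^sup>2) \<le> 1"
  shows "(1 / (2 * sqrt N)) *\<^sub>R (\<Sum>l<N. x l *\<^sub>R (f l - g l)) \<in> F"
proof -
  have neg: "- y \<in> F" if "y \<in> F" for y using F(2) that by (simp add: symmetric_set_def)
  have mid: "(1/2) *\<^sub>R (a - b) \<in> F" if "a \<in> F" "b \<in> F" for a b
    using convexD[OF F(1) that(1) neg[OF that(2)], of "1/2" "1/2"] by (simp add: scaleR_diff_right)
  have f0: "f 0 \<in> F" using fg[of 0] N by simp
  have zero: "0 \<in> F" using mid[OF f0 f0] by simp
  \<comment> \<open>The sign of \<open>x l\<close> is absorbed into the half difference, which lies
    in \<open>F\<close> for either sign. The index \<open>N\<close> carries the point 0 with the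
    missing weight, nonnegative because the sum of the \<open>\<bar>x l\<bar>\<close> is at most
    \<open>sqrt N\<close> by Cauchy-Schwarz; this is the gain over the merely convex case.\<close>
  define y where "y l = (if l < N then sgn (x l) *\<^sub>R ((1/2) *\<^sub>R (f l - g l)) else 0)" for l
  define w where "w l = (if l < N then \<bar>x l\<bar> / sqrt N else 1 - (\<Sum>l<N. \<bar>x l\<bar>) / sqrt N)" for l
  have yF: "y l \<in> F" for l
    using mid[of "f l" "g l"] mid[of "g l" "f l"] fg[of l] zero
    by (auto simp: y_def sgn_real_def scaleR_diff_right)
  have "(\<Sum>l<N. \<bar>x l\<bar>)\<^sup>2 \<le> (\<Sum>l<N. \<bar>x l\<bar>\<^sup>2) * card {..<N}"
    by (rule sum_squared_le_sum_of_squares)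
  also have "\<dots> \<le> 1 * real N" using mult_right_mono[OF x, of "real N"] by simp
  finally have "(\<Sum>l<N. \<bar>x l\<bar>) \<le> sqrt N" by (simp add: real_le_rsqrt)
  then have w0: "0 \<le> w l" for l using N by (auto simp: w_def)
  have "(\<Sum>l\<le>N. w l) = (\<Sum>l<N. w l) + w N" by (simp add: lessThan_Suc_atMost[symmetric])
  also have "\<dots> = 1" by (simp add: w_def sum_divide_distrib)
  finally have w1: "(\<Sum>l\<le>N. w l) = 1" .
  have "(\<Sum>l\<le>N. w l *\<^sub>R y l) \<in> F" by (rule convex_sum[OF _ F(1) w1]) (auto simp: w0 yF)
  also have "(\<Sum>l\<le>N. w l *\<^sub>R y l) = (\<Sum>l<N. w l *\<^sub>R y l)"
    by (simp add: lessThan_Suc_atMost[symmetric] y_def)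
  also have "\<dots> = (1 / (2 * sqrt N)) *\<^sub>R (\<Sum>l<N. x l *\<^sub>R (f l - g l))"
    unfolding scaleR_sum_right
  proof (rule sum.cong)
    fix l assume l: "l \<in> {..<N}"
    have "w l *\<^sub>R y l = (\<bar>x l\<bar> * sgn (x l) / (2 * sqrt N)) *\<^sub>R (f l - g l)"
      using l by (simp add: w_def y_def)
    then show "w l *\<^sub>R y l = (1 / (2 * sqrt N)) *\<^sub>R x l *\<^sub>R (f l - g l)"
      by (simp add: abs_mult_sgn)
  qed simp
  finally show ?thesis .
qed

text \<open>The point is an average of \<open>N\<close> points, the \<open>l\<close>-th one on the
  segment from \<open>g l\<close> to \<open>f l\<close> at the position given by \<open>x l\<close>,
  which is legitimate as \<open>\<bar>x l\<bar> \<le> 1\<close>. The centre is the average of the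
  midpoints.\<close>

lemma ball_embedding_convex:
  fixes F :: "'a::real_vector set" and N :: nat
  assumes F: "convex F" and N: "N \<ge> 1"
    and fg: "\<And>k. k < N \<Longrightarrow> f k \<in> F \<and> g k \<in> F" and x: "(\<Sum>l<N. (x l)\<^sup>2) \<le> 1"
  shows "(\<Sum>l<N. (1 / (2 * real N)) *\<^sub>R (f l + g l)) + (1 / (2 * real N)) *\<^sub>R (\<Sum>l<N. x l *\<^sub>R (f l - g l)) \<in> F"
proof -
  define y where "y l = ((1 + x l) / 2) *\<^sub>R f l + ((1 - x l) / 2) *\<^sub>R g l" for l
  have yF: "y l \<in> F" if l: "l < N" for l
  proof -
    have "(x l)\<^sup>2 \<le> (\<Sum>l<N. (x l)\<^sup>2)" using l by (intro member_le_sum) auto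
    then have "\<bar>x l\<bar> \<le> 1" using x by (simp add: abs_square_le_1[symmetric])
    then show ?thesis
      unfolding y_def using fg[OF l] by (intro convexD[OF F]) (auto simp: field_simps)
  qed
  have "(\<Sum>l<N. (1 / real N) *\<^sub>R y l) \<in> F"
    using N by (intro convex_sum[OF _ F]) (auto simp: yF)
  also have "(\<Sum>l<N. (1 / real N) *\<^sub>R y l)
      = (\<Sum>l<N. (1 / (2 * real N)) *\<^sub>R (f l + g l)) + (1 / (2 * real N)) *\<^sub>R (\<Sum>l<N. x l *\<^sub>R (f l - g l))"
    unfolding scaleR_sum_right sum.distrib[symmetric] y_def
  proof (rule sum.cong)
    fix l
    show "(1 / real N) *\<^sub>R (((1 + x l) / 2) *\<^sub>R f l + ((1 - x l) / 2) *\<^sub>R g l)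
      = (1 / (2 * real N)) *\<^sub>R (f l + g l) + (1 / (2 * real N)) *\<^sub>R x l *\<^sub>R (f l - g l)"
      by (simp add: scaleR_add_right scaleR_diff_right scaleR_add_left scaleR_diff_left
          add_divide_distrib diff_divide_distrib mult.commute)
  qed simp
  finally show ?thesis .
qed

text \<open>The functional attached to \<open>y\<close> is the inner product with
  \<open>y / norm y\<close>, which is zero for \<open>y = 0\<close>. Symmetry of the inner product
  turns the triangular condition into orthogonality, so Bessel's inequality holds with constant
  1.\<close>

lemma hilbert_norm_functionals:
  assumes "hilbert_norm TYPE('b::real_normed_vector)"
  shows "\<exists>nf :: 'b::real_normed_vector \<Rightarrow> 'b \<Rightarrow> real. (\<forall>y. bounded_linear (nf y)) \<and> (\<forall>y. nf y y = norm y) \<and>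
    (\<forall>(w :: nat \<Rightarrow> 'b) N y. (\<forall>k<N. w k \<noteq> 0) \<longrightarrow> (\<forall>i k. i < k \<longrightarrow> k < N \<longrightarrow> nf (w i) (w k) = 0) \<longrightarrow>
      (\<Sum>l<N. (nf (w l) y)\<^sup>2) \<le> (norm y)\<^sup>2)"
proof -
  obtain ip :: "'b \<Rightarrow> 'b \<Rightarrow> real" where sym: "\<And>x y. ip x y = ip y x" and lin: "\<And>x. linear (ip x)"
    and ipn: "\<And>x. norm x = sqrt (ip x x)" using assms unfolding hilbert_norm_def by blast
  have nn: "0 \<le> ip x x" for x using ipn[of x] norm_ge_zero[of x] by simp
  have n2: "(norm x)\<^sup>2 = ip x x" for x unfolding ipn using nn by simp
  define nf where "nf y z = ip y z / norm y" for y z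
  have bessel: "(\<Sum>l<N. (nf (w l) y)\<^sup>2) \<le> (norm y)\<^sup>2"
    if w0: "\<And>k. k < N \<Longrightarrow> w k \<noteq> 0" and orth: "\<And>i k. i < k \<Longrightarrow> k < N \<Longrightarrow> nf (w i) (w k) = 0"
    for w :: "nat \<Rightarrow> 'b" and N y
  proof -
    have o: "ip (w i) (w k) = 0" if "i < N" "k < N" "i \<noteq> k" for i k
    proof -
      have "ip (w i) (w k) = 0" if "i < k" "k < N" for i k
        using orth[OF that] w0[of i] that by (simp add: nf_def)
      then show ?thesis using that sym by (metis linorder_neqE_nat)
    qed
    define t where "t l = ip (w l) y / ip (w l) (w l)" for l
    define r where "r = y - (\<Sum>l<N. t l *\<^sub>R w l)"
    have pos: "ip (w l) (w l) \<noteq> 0" if "l < N" for l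
      using w0[OF that] n2[of "w l"] by auto
    have ipr: "ip z r = ip z y - (\<Sum>l<N. t l * ip z (w l))" for z
      unfolding r_def linear_diff[OF lin] linear_sum[OF lin] linear_scale[OF lin] by simp
    have wr: "ip (w k) r = 0" if k: "k < N" for k
    proof -
      have "ip (w k) r = ip (w k) y - (\<Sum>l<N. t l * ip (w k) (w l))"
        by (rule ipr)
      also have "(\<Sum>l<N. t l * ip (w k) (w l)) = (\<Sum>l<N. if k = l then t l * ip (w k) (w l) else 0)"
        using o k by (intro sum.cong) auto
      also have "\<dots> = ip (w k) y" using k pos[OF k] by (simp add: t_def)
      finally show ?thesis by simp
    qed
    \<comment> \<open>The residual \<open>r\<close> is orthogonal to every \<open>w l\<close>;
      nonnegativity of its square is Bessel's inequality.\<close>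
    have "ip r r = ip r y - (\<Sum>l<N. t l * ip r (w l))"
      by (rule ipr)
    also have "(\<Sum>l<N. t l * ip r (w l)) = 0"
      using wr sym by (intro sum.neutral) auto
    also have "ip r y = ip y y - (\<Sum>l<N. t l * ip (w l) y)"
    proof -
      have "ip y (w l) = ip (w l) y" for l by (rule sym)
      then show ?thesis using sym[of r y] ipr[of y] by simp
    qed
    finally have "(\<Sum>l<N. t l * ip (w l) y) \<le> ip y y" using nn[of r] by simp
    moreover have "(nf (w l) y)\<^sup>2 = t l * ip (w l) y" for l
      unfolding nf_def t_def power_divide n2 by (simp add: power2_eq_square)
    ultimately show ?thesis by (simp add: n2)
  qed
  have self: "nf y y = norm y" for y
    by (simp add: nf_def n2[symmetric] power2_eq_square)
  have "bounded_linear (nf y)" for y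
  proof (rule bounded_linear_intro[where K = 1])
    show "nf y (a + b) = nf y a + nf y b" for a b
      by (simp add: nf_def linear_add[OF lin] add_divide_distrib)
    show "nf y (c *\<^sub>R a) = c *\<^sub>R nf y a" for c a
      by (simp add: nf_def linear_scale[OF lin])
    show "norm (nf y a) \<le> norm a * 1" for a
    proof (cases "y = 0")
      case True
      then show ?thesis by (simp add: nf_def)
    next
      case False
      \<comment> \<open>Cauchy-Schwarz, as Bessel's inequality for the single vector
        \<open>y\<close>.\<close>
      have "(\<Sum>l<1::nat. (nf y a)\<^sup>2) \<le> (norm a)\<^sup>2"
        using False by (intro bessel[of "1::nat" "\<lambda>_. y" a]) auto
      then show ?thesis by (simp add: abs_le_square_iff[symmetric])
    qed
  qed
  then show ?thesis using self bessel by blast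
qed

text \<open>In a general normed space each summand is bounded separately, which costs the constant
  \<open>N\<close>; in the theorem this is an additional factor \<open>sqrt N\<close> compared with
  Hilbert spaces.\<close>

lemma norming_functionals:
  "\<exists>nf :: 'b::real_normed_vector \<Rightarrow> 'b \<Rightarrow> real. (\<forall>y. bounded_linear (nf y)) \<and> (\<forall>y. nf y y = norm y) \<and>
    (\<forall>(w :: nat \<Rightarrow> 'b) N y. (\<Sum>l<N. (nf (w l) y)\<^sup>2) \<le> real N * (norm y)\<^sup>2)"
proof -
  have "\<forall>y::'b. \<exists>f. bounded_linear f \<and> (\<forall>x. \<bar>f x\<bar> \<le> norm x) \<and> f y = norm y"
    using norming_functional_exists by blast
  from choice[OF this] obtain nf :: "'b \<Rightarrow> 'b \<Rightarrow> real" where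
    nf: "\<And>y. bounded_linear (nf y)" "\<And>y x. \<bar>nf y x\<bar> \<le> norm x" "\<And>y. nf y y = norm y" by blast
  have "(\<Sum>l<N. (nf (w l) y)\<^sup>2) \<le> real N * (norm y)\<^sup>2" for w :: "nat \<Rightarrow> 'b" and N y
  proof -
    have "(\<Sum>l<N. (nf (w l) y)\<^sup>2) \<le> (\<Sum>l<N. (norm y)\<^sup>2)"
      using nf(2) by (intro sum_mono) (simp add: abs_le_square_iff[symmetric])
    then show ?thesis by simp
  qed
  with nf show ?thesis by blast
qed

theorem theorem5p1:
  fixes S :: "'a::banach \<Rightarrow> 'b::banach" and F :: "'a set" and n :: nat
  assumes "bounded_linear S" and "convex F" and "n \<ge> 1"
  shows "eroot (2*n) (\<Prod>k<2*n. e_det_non S F k)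
           \<le> ennreal (2 powr (7/2) * real n powr (3/2)) * eroot n (\<Prod>k<n. e_ran TYPE('c) S F k)
       \<and> (symmetric_set F \<or> hilbert_norm TYPE('b) \<longrightarrow>
         eroot (2*n) (\<Prod>k<2*n. e_det_non S F k)
           \<le> ennreal (2 powr (7/2) * real n) * eroot n (\<Prod>k<n. e_ran TYPE('c) S F k))
       \<and> (symmetric_set F \<and> hilbert_norm TYPE('b) \<longrightarrow>
         eroot (2*n) (\<Prod>k<2*n. e_det_non S F k)
           \<le> ennreal (2 powr (7/2) * real n powr (1/2)) * eroot n (\<Prod>k<n. e_ran TYPE('c) S F k))"
proof -
  define N where "N = 2 * n"
  have N: "N \<ge> 1" using assms(3) by (simp add: N_def)
  \<comment> \<open>The scales \<open>\<alpha>\<close> provided by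
    \<open>ball_embedding_convex\<close> and \<open>ball_embedding_symmetric\<close>.\<close>
  define conv where "conv = 1 / (2 * real N)"
  define symm where "symm = 1 / (2 * sqrt N)"
  have pos: "0 < conv" "0 < symm" using N by (auto simp: conv_def symm_def)
  let ?bound = "\<lambda>C. eroot (2*n) (\<Prod>k<2*n. e_det_non S F k) \<le> ennreal C * eroot n (\<Prod>k<n. e_ran TYPE('c) S F k)"
  have ball_conv: "\<exists>ctr. \<forall>x. (\<Sum>l<2 * n. (x l)\<^sup>2) \<le> 1 \<longrightarrow> ctr + conv *\<^sub>R (\<Sum>l<2 * n. x l *\<^sub>R (f l - g l)) \<in> F"
    if "\<And>k. k < 2 * n \<Longrightarrow> f k \<in> F \<and> g k \<in> F" for f g
    using ball_embedding_convex[OF assms(2) N, of f g] that unfolding conv_def N_def by blast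
  have ball_symm: "\<exists>ctr. \<forall>x. (\<Sum>l<2 * n. (x l)\<^sup>2) \<le> 1 \<longrightarrow> ctr + symm *\<^sub>R (\<Sum>l<2 * n. x l *\<^sub>R (f l - g l)) \<in> F"
    if "symmetric_set F" "\<And>k. k < 2 * n \<Longrightarrow> f k \<in> F \<and> g k \<in> F" for f g
    using ball_embedding_symmetric[OF assms(2) that(1) N, of f g] that(2)
    unfolding symm_def N_def by (intro exI[of _ 0]) auto
  have general: "?bound (2 * sqrt N / \<alpha>)"
    if \<alpha>: "0 < \<alpha>" and ball: "\<And>f g. (\<And>k. k < 2 * n \<Longrightarrow> f k \<in> F \<and> g k \<in> F) \<Longrightarrow>
      \<exists>ctr. \<forall>x. (\<Sum>l<2 * n. (x l)\<^sup>2) \<le> 1 \<longrightarrow> ctr + \<alpha> *\<^sub>R (\<Sum>l<2 * n. x l *\<^sub>R (f l - g l)) \<in> F" for \<alpha>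
  proof -
    obtain nf :: "'b \<Rightarrow> 'b \<Rightarrow> real" where nf: "\<And>y. bounded_linear (nf y)" "\<And>y. nf y y = norm y"
      "\<And>(w :: nat \<Rightarrow> 'b) N y. (\<Sum>l<N. (nf (w l) y)\<^sup>2) \<le> real N * (norm y)\<^sup>2" using norming_functionals[where 'b = 'b] by blast
    have "(\<Sum>l<2 * n. (nf (w l) y)\<^sup>2) \<le> (sqrt N)\<^sup>2 * (norm y)\<^sup>2" for w y
      using nf(3)[where N = "2 * n" and w = w and y = y] by (simp add: N_def)
    then show ?thesis
      using N by (intro error_product_comparison[OF assms(1,3) \<alpha> _ nf(1,2) _ ball]) auto
  qed
  have hilbert: "?bound (2 * 1 / \<alpha>)"
    if hilb: "hilbert_norm TYPE('b)" and \<alpha>: "0 < \<alpha>" and ball: "\<And>f g. (\<And>k. k < 2 * n \<Longrightarrow> f k \<in> F \<and> g k \<in> F) \<Longrightarrow>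
      \<exists>ctr. \<forall>x. (\<Sum>l<2 * n. (x l)\<^sup>2) \<le> 1 \<longrightarrow> ctr + \<alpha> *\<^sub>R (\<Sum>l<2 * n. x l *\<^sub>R (f l - g l)) \<in> F" for \<alpha>
  proof -
    obtain nf :: "'b \<Rightarrow> 'b \<Rightarrow> real" where nf: "\<And>y. bounded_linear (nf y)" "\<And>y. nf y y = norm y"
      "\<And>(w :: nat \<Rightarrow> 'b) N y. (\<And>k. k < N \<Longrightarrow> w k \<noteq> 0) \<Longrightarrow>
        (\<And>i k. i < k \<Longrightarrow> k < N \<Longrightarrow> nf (w i) (w k) = 0) \<Longrightarrow> (\<Sum>l<N. (nf (w l) y)\<^sup>2) \<le> (norm y)\<^sup>2"
      using hilbert_norm_functionals[OF hilb] by blast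
    show ?thesis
      using nf(3) by (intro error_product_comparison[OF assms(1,3) \<alpha> _ nf(1,2) _ ball]) auto
  qed
  have weaken: "?bound D" if "?bound C" "C \<le> D" for C D
    using that(1) mult_right_mono[OF ennreal_leI[OF that(2)], of "eroot n (\<Prod>k<n. e_ran TYPE('c) S F k)"]
    by (rule order.trans) simp
  have two: "2 powr (7/2) = 8 * sqrt 2"
  proof -
    have "(2::real) powr (7/2) = 2 powr (3 + 1/2)" by simp
    also have "\<dots> = 8 * sqrt 2" unfolding powr_add by (simp add: powr_half_sqrt)
    finally show ?thesis .
  qed
  have n32: "real n powr (3/2) = real n * sqrt n"
  proof -
    have "real n powr (3/2) = real n powr (1 + 1/2)" by simp
    also have "\<dots> = real n * sqrt n" unfolding powr_add using assms(3) by (simp add: powr_half_sqrt)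
    finally show ?thesis .
  qed
  have n12: "real n powr (1/2) = sqrt n" by (simp add: powr_half_sqrt)
  have sqrtN: "sqrt N = sqrt 2 * sqrt n" by (simp add: N_def real_sqrt_mult)
  have s2: "1 \<le> sqrt (2::real)" by simp
  \<comment> \<open>The constant is exact here: \<open>4 N^(3/2)\<close> with \<open>N = 2 n\<close>
    equals \<open>2^(7/2) n^(3/2)\<close>.\<close>
  have 1: "2 * sqrt N / conv = 2 powr (7/2) * real n powr (3/2)"
    by (simp add: conv_def two n32 sqrtN) (simp add: N_def)
  \<comment> \<open>With only one of the two extra assumptions the constant is
    \<open>4 N = 8 n\<close> in either case, and \<open>8 \<le> 8 sqrt 2 = 2^(7/2)\<close>.\<close>
  have 2: "2 * sqrt N / symm \<le> 2 powr (7/2) * real n"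
  proof -
    have "2 * sqrt N / symm = 4 * (sqrt N * sqrt N)" by (simp add: symm_def)
    also have "\<dots> = 8 * real n" by (simp add: N_def)
    also have "\<dots> \<le> 8 * sqrt 2 * real n" using s2 by (intro mult_right_mono) auto
    finally show ?thesis by (simp add: two)
  qed
  have 3: "2 * 1 / conv \<le> 2 powr (7/2) * real n"
  proof -
    have "2 * 1 / conv = 8 * real n" by (simp add: conv_def N_def)
    also have "\<dots> \<le> 8 * sqrt 2 * real n" using s2 by (intro mult_right_mono) auto
    finally show ?thesis by (simp add: two)
  qed
  \<comment> \<open>With both assumptions the constant is \<open>4 sqrt N = 2^(5/2) sqrt n\<close>,
    half of the stated one.\<close>
  have 4: "2 * 1 / symm \<le> 2 powr (7/2) * real n powr (1/2)"
    by (simp add: symm_def two n12 sqrtN)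
  show ?thesis
  proof (intro conjI impI)
    show "?bound (2 powr (7/2) * real n powr (3/2))"
      using general[OF pos(1) ball_conv] unfolding 1 .
    show "?bound (2 powr (7/2) * real n)" if "symmetric_set F \<or> hilbert_norm TYPE('b)"
      using that
    proof
      assume "symmetric_set F"
      from weaken[OF general[OF pos(2) ball_symm[OF this]] 2] show ?thesis .
    next
      assume "hilbert_norm TYPE('b)"
      from weaken[OF hilbert[OF this pos(1) ball_conv] 3] show ?thesis .
    qed
    show "?bound (2 powr (7/2) * real n powr (1/2))" if "symmetric_set F \<and> hilbert_norm TYPE('b)"
      using weaken[OF hilbert[OF conjunct2[OF that] pos(2) ball_symm[OF conjunct1[OF that]]] 4] .
  qed
qed

end
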